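(* Let $a\in\mathbb R$, $a<b\le\infty$, $m\in\mathbb N$ and $c_1,\dots,c_m\in\mathbb R$. Assume that for each $i=1,\dots,m$ the mapping $f_i:HK_{loc}([a,b))^m\to\mathcal A_D([a,b))$ is increasing, and that the system $$y_i'=f_i(y_1,\dots,y_m),\quad y_i(a)=c_i,\quad i=1,\dots,m,\qquad(\ast)$$ has in $\mathcal D^{lc}([a,b))^m$ a subsolution $\underline y=(\underline y_1,\dots,\underline y_m)$ and a supersolution $\overline y=(\overline y_1,\dots,\overline y_m)$ with $\underline y_i\le\overline y_i$ for each $i=1,\dots,m$. Then the system $(\ast)$ has in the order interval $[\underline y,\overline y]=\{y\in\mathcal D^{lc}([a,b))^m:\underline y\le y\le\overline y\}$ a smallest solution and a greatest solution, and these are increasing with respect to $f_i$ and $c_i$, $i=1,\dots,m$. The latter means: if $\hat f_i$ and $\hat c_i$, $i=1,\dots,m$, satisfy the same hypotheses (with the same $\underline y,\overline y$), and $f_i(x)\preceq\hat f_i(x)$ for all $x\in HK_{loc}([a,b))^m$ and $c_i\le\hat c_i$ for all $i$, then the smallest (respectively greatest) solution in $[\underline y,\overline y]$ for the data $(f_i,c_i)$ is $\le$ the smallest (respectively greatest) solution for the data $(\hat f_i,\hat c_i)$.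
   Context: Let $I=[a,b)$. $\mathcal D'$ is the space of distributions on $I$: continuous linear functionals on the space $\mathcal D$ of infinitely differentiable functions $\varphi:\mathbb R\to\mathbb R$ whose support is a compact subset of $I$, with $\varphi_n\to\varphi$ in $\mathcal D$ if all supports lie in one compact $K\subseteq I$ and all derivatives converge uniformly on $K$. The derivative is $\langle T',\varphi\rangle=-\langle T,\varphi'\rangle$, and a locally Henstock--Kurzweil ($HK$) integrable function $H$ (i.e. $HK$ integrable on every compact subinterval of $I$) is identified with $\varphi\mapsto\int_I H\varphi\,dt$. $\mathcal D^{lc}([a,b))$ is the space of functions $[a,b)\to\mathbb R$ that are locally $HK$ integrable, right continuous at $a$ and left continuous on $(a,b)$, ordered pointwise. $\mathcal A_D([a,b))$ is the set of distributions $f$ with $f=F'$ for some $F\in\mathcal D^{lc}([a,b))$; $F$ is unique up to a constant and $\int_a^xf:=F(x)-F(a)$. It is partially ordered by: $f\preceq g$ iff $\int_a^xf\le\int_a^xg$ for all $x\in[a,b)$. $HK_{loc}([a,b))$ is the space of locally $HK$ integrable functions on $[a,b)$, with a.e. equal functions identified, ordered a.e. pointwise. Products of these function spaces are ordered componentwise. A function in $\mathcal D^{lc}([a,b))$ is regarded as an element of $HK_{loc}([a,b))$ when $f_i$ is applied to it. A mapping $f$ between partially ordered sets is increasing if $x\le y$ implies $f(x)\preceq f(y)$. $(y_1,\dots,y_m)\in\mathcal D^{lc}([a,b))^m$ is a subsolution of $(\ast)$ if $y_i'\preceq f_i(y_1,\dots,y_m)$ in $\mathcal A_D([a,b))$ and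 $y_i(a)\le c_i$ for every $i$; a supersolution if the reversed inequalities hold; a solution if equalities hold. *)

theory Defs
  imports "HOL-Analysis.Analysis" "HOL-Library.FuncSet"
begin

text \<open>
  The interval \<open>[a,b)\<close>, where \<open>b\<close> may be infinite.  Functions with domain \<open>[a,b)\<close> are represented
  by extensional functions (value \<open>undefined\<close> outside the domain), so that they are equal iff they
  agree on \<open>[a,b)\<close>; likewise for functionals on the space of test functions.  A tuple indexed by
  \<open>1, ..., m\<close> is a function on a finite index type with \<open>m\<close> elements.
\<close>

definition Ico :: "real \<Rightarrow> ereal \<Rightarrow> real set" where
  "Ico a b = {t. a \<le> t \<and> ereal t < b}"


subsection \<open>Test functions and distributions\<close>

definition support :: "(real \<Rightarrow> real) \<Rightarrow> real set" where
  "support \<phi> = closure {t. \<phi> t \<noteq> 0}"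

definition test_functions :: "real \<Rightarrow> ereal \<Rightarrow> (real \<Rightarrow> real) set" where
  "test_functions a b =
     {\<phi>. (\<forall>k t. (deriv ^^ k) \<phi> differentiable (at t)) \<and>
         compact (support \<phi>) \<and> support \<phi> \<subseteq> Ico a b}"

definition test_converges ::
    "real \<Rightarrow> ereal \<Rightarrow> (nat \<Rightarrow> real \<Rightarrow> real) \<Rightarrow> (real \<Rightarrow> real) \<Rightarrow> bool" where
  "test_converges a b \<phi>s \<phi> \<longleftrightarrow>
     (\<exists>K. compact K \<and> K \<subseteq> Ico a b \<and> (\<forall>n. support (\<phi>s n) \<subseteq> K) \<and> support \<phi> \<subseteq> K \<and>
        (\<forall>k. uniform_limit K (\<lambda>n. (deriv ^^ k) (\<phi>s n)) ((deriv ^^ k) \<phi>) sequentially))"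

type_synonym dist = "(real \<Rightarrow> real) \<Rightarrow> real"

definition distributions :: "real \<Rightarrow> ereal \<Rightarrow> dist set" where
  "distributions a b =
     {T \<in> extensional (test_functions a b).
        (\<forall>\<phi>\<in>test_functions a b. \<forall>\<psi>\<in>test_functions a b. T (\<lambda>t. \<phi> t + \<psi> t) = T \<phi> + T \<psi>) \<and>
        (\<forall>\<phi>\<in>test_functions a b. \<forall>r. T (\<lambda>t. r * \<phi> t) = r * T \<phi>) \<and>
        (\<forall>\<phi>s \<phi>. (\<forall>n. \<phi>s n \<in> test_functions a b) \<longrightarrow> \<phi> \<in> test_functions a b \<longrightarrow>
            test_converges a b \<phi>s \<phi> \<longrightarrow> (\<lambda>n. T (\<phi>s n)) \<longlonglongrightarrow> T \<phi>)}"

definition dist_deriv :: "real \<Rightarrow> ereal \<Rightarrow> dist \<Rightarrow> dist" where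
  "dist_deriv a b T = (\<lambda>\<phi>\<in>test_functions a b. - T (deriv \<phi>))"

text \<open>In HOL-Analysis, \<open>integrable_on\<close> and \<open>integral\<close> refer to the Henstock--Kurzweil integral.\<close>

definition dist_of_fun :: "real \<Rightarrow> ereal \<Rightarrow> (real \<Rightarrow> real) \<Rightarrow> dist" where
  "dist_of_fun a b H = (\<lambda>\<phi>\<in>test_functions a b. integral (Ico a b) (\<lambda>t. H t * \<phi> t))"


subsection \<open>Locally Henstock--Kurzweil integrable functions\<close>

definition locally_HK :: "real \<Rightarrow> ereal \<Rightarrow> (real \<Rightarrow> real) set" where
  "locally_HK a b =
     {H \<in> extensional (Ico a b). \<forall>s t. {s..t} \<subseteq> Ico a b \<longrightarrow> H integrable_on {s..t}}"

definition ae_rel :: "real \<Rightarrow> ereal \<Rightarrow> ((real \<Rightarrow> real) \<times> (real \<Rightarrow> real)) set" where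
  "ae_rel a b =
     {(x, y). x \<in> locally_HK a b \<and> y \<in> locally_HK a b \<and> (AE t in lebesgue_on (Ico a b). x t = y t)}"

type_synonym hk_class = "(real \<Rightarrow> real) set"

definition HK_loc :: "real \<Rightarrow> ereal \<Rightarrow> hk_class set" where
  "HK_loc a b = locally_HK a b // ae_rel a b"

definition hk_class_of :: "real \<Rightarrow> ereal \<Rightarrow> (real \<Rightarrow> real) \<Rightarrow> hk_class" where
  "hk_class_of a b x = ae_rel a b `` {x}"

definition HK_le :: "real \<Rightarrow> ereal \<Rightarrow> hk_class \<Rightarrow> hk_class \<Rightarrow> bool" where
  "HK_le a b X Y \<longleftrightarrow> (\<exists>x\<in>X. \<exists>y\<in>Y. AE t in lebesgue_on (Ico a b). x t \<le> y t)"

definition HK_tuples :: "real \<Rightarrow> ereal \<Rightarrow> ('m \<Rightarrow> hk_class) set" where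
  "HK_tuples a b = {X. \<forall>i. X i \<in> HK_loc a b}"

definition HK_tuple_le :: "real \<Rightarrow> ereal \<Rightarrow> ('m \<Rightarrow> hk_class) \<Rightarrow> ('m \<Rightarrow> hk_class) \<Rightarrow> bool" where
  "HK_tuple_le a b X Y \<longleftrightarrow> (\<forall>i. HK_le a b (X i) (Y i))"


subsection \<open>Primitives and distributionally integrable distributions\<close>

definition Dlc :: "real \<Rightarrow> ereal \<Rightarrow> (real \<Rightarrow> real) set" where
  "Dlc a b =
     {F \<in> locally_HK a b. continuous (at_right a) F \<and>
        (\<forall>t. a < t \<and> ereal t < b \<longrightarrow> continuous (at_left t) F)}"

definition A_D :: "real \<Rightarrow> ereal \<Rightarrow> dist set" where
  "A_D a b = {f \<in> distributions a b. \<exists>F\<in>Dlc a b. f = dist_deriv a b (dist_of_fun a b F)}"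

text \<open>
  \<open>dist_integral a b f x\<close> is the integral of \<open>f\<close> from \<open>a\<close> to \<open>x\<close>, i.e. \<open>F x - F a\<close> for any
  \<open>F\<close> in \<open>Dlc a b\<close> whose distributional derivative is \<open>f\<close>; such an \<open>F\<close> is unique up to an
  additive constant.
\<close>

definition dist_integral :: "real \<Rightarrow> ereal \<Rightarrow> dist \<Rightarrow> real \<Rightarrow> real" where
  "dist_integral a b f x =
     (THE r. \<exists>F\<in>Dlc a b. f = dist_deriv a b (dist_of_fun a b F) \<and> r = F x - F a)"

definition A_D_le :: "real \<Rightarrow> ereal \<Rightarrow> dist \<Rightarrow> dist \<Rightarrow> bool" where
  "A_D_le a b f g \<longleftrightarrow> (\<forall>x\<in>Ico a b. dist_integral a b f x \<le> dist_integral a b g x)"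

definition Dlc_tuples :: "real \<Rightarrow> ereal \<Rightarrow> ('m \<Rightarrow> real \<Rightarrow> real) set" where
  "Dlc_tuples a b = {y. \<forall>i. y i \<in> Dlc a b}"

definition Dlc_tuple_le ::
    "real \<Rightarrow> ereal \<Rightarrow> ('m \<Rightarrow> real \<Rightarrow> real) \<Rightarrow> ('m \<Rightarrow> real \<Rightarrow> real) \<Rightarrow> bool" where
  "Dlc_tuple_le a b y z \<longleftrightarrow> (\<forall>i. \<forall>t\<in>Ico a b. y i t \<le> z i t)"


subsection \<open>The system \<open>y\<^sub>i' = f\<^sub>i (y\<^sub>1, ..., y\<^sub>m)\<close>, \<open>y\<^sub>i a = c\<^sub>i\<close>\<close>

type_synonym 'm rhs = "'m \<Rightarrow> ('m \<Rightarrow> hk_class) \<Rightarrow> dist"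

definition increasing_maps :: "real \<Rightarrow> ereal \<Rightarrow> 'm rhs \<Rightarrow> bool" where
  "increasing_maps a b f \<longleftrightarrow>
     (\<forall>i. f i \<in> HK_tuples a b \<rightarrow> A_D a b \<and>
          monotone_on (HK_tuples a b) (HK_tuple_le a b) (A_D_le a b) (f i))"

definition subsolution ::
    "real \<Rightarrow> ereal \<Rightarrow> 'm rhs \<Rightarrow> ('m \<Rightarrow> real) \<Rightarrow> ('m \<Rightarrow> real \<Rightarrow> real) \<Rightarrow> bool" where
  "subsolution a b f c y \<longleftrightarrow> y \<in> Dlc_tuples a b \<and>
     (\<forall>i. A_D_le a b (dist_deriv a b (dist_of_fun a b (y i))) (f i (\<lambda>j. hk_class_of a b (y j))) \<and>
          y i a \<le> c i)"

definition supersolution ::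
    "real \<Rightarrow> ereal \<Rightarrow> 'm rhs \<Rightarrow> ('m \<Rightarrow> real) \<Rightarrow> ('m \<Rightarrow> real \<Rightarrow> real) \<Rightarrow> bool" where
  "supersolution a b f c y \<longleftrightarrow> y \<in> Dlc_tuples a b \<and>
     (\<forall>i. A_D_le a b (f i (\<lambda>j. hk_class_of a b (y j))) (dist_deriv a b (dist_of_fun a b (y i))) \<and>
          c i \<le> y i a)"

definition solution ::
    "real \<Rightarrow> ereal \<Rightarrow> 'm rhs \<Rightarrow> ('m \<Rightarrow> real) \<Rightarrow> ('m \<Rightarrow> real \<Rightarrow> real) \<Rightarrow> bool" where
  "solution a b f c y \<longleftrightarrow> y \<in> Dlc_tuples a b \<and>
     (\<forall>i. dist_deriv a b (dist_of_fun a b (y i)) = f i (\<lambda>j. hk_class_of a b (y j)) \<and>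
          y i a = c i)"

definition order_interval ::
    "real \<Rightarrow> ereal \<Rightarrow> ('m \<Rightarrow> real \<Rightarrow> real) \<Rightarrow> ('m \<Rightarrow> real \<Rightarrow> real) \<Rightarrow> ('m \<Rightarrow> real \<Rightarrow> real) set" where
  "order_interval a b u v = {y \<in> Dlc_tuples a b. Dlc_tuple_le a b u y \<and> Dlc_tuple_le a b y v}"

definition smallest_solution ::
    "real \<Rightarrow> ereal \<Rightarrow> 'm rhs \<Rightarrow> ('m \<Rightarrow> real) \<Rightarrow> ('m \<Rightarrow> real \<Rightarrow> real) set \<Rightarrow> ('m \<Rightarrow> real \<Rightarrow> real) \<Rightarrow> bool"
  where
  "smallest_solution a b f c S y \<longleftrightarrow> y \<in> S \<and> solution a b f c y \<and>
     (\<forall>z\<in>S. solution a b f c z \<longrightarrow> Dlc_tuple_le a b y z)"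

definition greatest_solution ::
    "real \<Rightarrow> ereal \<Rightarrow> 'm rhs \<Rightarrow> ('m \<Rightarrow> real) \<Rightarrow> ('m \<Rightarrow> real \<Rightarrow> real) set \<Rightarrow> ('m \<Rightarrow> real \<Rightarrow> real) \<Rightarrow> bool"
  where
  "greatest_solution a b f c S y \<longleftrightarrow> y \<in> S \<and> solution a b f c y \<and>
     (\<forall>z\<in>S. solution a b f c z \<longrightarrow> Dlc_tuple_le a b z y)"

end

theory Submission
  imports Defs
begin

text \<open>
  A solution of the system is a fixed point of the operator \<open>picard\<close> that sends \<open>u\<close> to the tuple
  \<open>x \<mapsto> c\<^sub>i + \<integral>\<^sub>a\<^sup>x f\<^sub>i(u)\<close>.  This operator depends only on the almost-everywhere class of \<open>u\<close>, it
  is increasing, and it takes values in \<open>Dlc\<close>.  No continuity of the \<open>f\<^sub>i\<close> is available, so the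
  fixed points come from order alone, as in the Knaster--Tarski theorem.

  The order interval of \<open>Dlc\<close> is the wrong place to apply that theorem: a pointwise infimum of left
  continuous functions need not be left continuous.  The larger set \<open>HK_between\<close> of locally
  integrable tuples that lie a.e. between the two bounds, preordered by a.e. inequality, does have
  all infima.  Indeed, any nonempty family of measurable functions on a \<open>\<sigma>\<close>-finite space with a common lower
  bound has an essential infimum (\<open>essential_infimum\<close>), and a measurable function between two
  Henstock--Kurzweil integrable functions is integrable, because its difference to the lower one
  is dominated by an integrable function (\<open>locally_HK_between\<close>).  The sub- and
  supersolution inequalities, together with monotonicity, show that \<open>picard\<close> maps \<open>HK_between\<close>
  into itself.  Hence there is, up to a.e. equality, a least tuple \<open>w\<close> with \<open>picard w \<le> w\<close> a.e.,
  and \<open>w\<close> equals \<open>picard w\<close> almost everywhere.  Applying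
  \<open>picard\<close> once more turns this a.e. equality into the equality \<open>picard (picard w) = picard w\<close>, and
  \<open>picard w\<close> lies in \<open>Dlc\<close>: it is a solution.  It is in fact below every \<open>z\<close> of the order interval
  with \<open>picard z \<le> z\<close>, and a solution for larger data is such a \<open>z\<close>; this gives the monotone
  dependence on the data.  Greatest solutions are obtained dually.

  The passage between distributions and their primitives rests on one analytic fact: a primitive in
  \<open>Dlc\<close> is determined up to a constant (\<open>primitive_unique\<close>).  If the distributional derivative of
  \<open>D\<close> vanishes, test it against the difference of two translates of a smooth step function; the
  derivative of this test function is the difference of two bumps supported immediately to the left of
  \<open>s\<close> and of \<open>t\<close>.  Thus two weighted averages of \<open>D\<close> agree, and left continuity yields
  \<open>D s = D t\<close>.
\<close>

section \<open>Smooth functions that vanish on a half-line\<close>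

text \<open>
  The functions \<open>p(1/x) e\<^bsup>-1/x\<^esup>\<close>, extended by \<open>0\<close>.  The polynomial factor is there because
  differentiating \<open>e\<^bsup>-1/x\<^esup>\<close> produces one; with it, the family is closed under derivation.
\<close>

definition flat :: "real poly \<Rightarrow> real \<Rightarrow> real" where
  "flat p x = (if x > 0 then poly p (1 / x) * exp (- (1 / x)) else 0)"

lemma poly_times_exp_minus_tendsto_0:
  "((\<lambda>u. poly p u * exp (- u)) \<longlongrightarrow> (0::real)) at_top"
proof -
  have "((\<lambda>u. \<Sum>i\<le>degree p. coeff p i * (u ^ i / exp u)) \<longlongrightarrow> (\<Sum>i\<le>degree p. coeff p i * 0)) at_top"
    by (intro tendsto_intros tendsto_power_div_exp_0)
  then show ?thesis
    by (simp add: poly_altdef sum_distrib_right exp_minus divide_inverse mult.assoc)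
qed

text \<open>
  With \<open>u = 1/x\<close>, the chain rule gives the derivative \<open>u\<^sup>2 (p(u) - p'(u)) e\<^bsup>-u\<^esup>\<close> for \<open>x > 0\<close>.
  At \<open>0\<close> the difference quotient \<open>flat p h / h\<close> is again of the form \<open>q(1/h) e\<^bsup>-1/h\<^esup>\<close> for \<open>h > 0\<close>, where \<open>q\<close> is the polynomial \<open>u p(u)\<close>, and the exponential wins.
\<close>

lemma flat_has_derivative:
  "(flat p has_real_derivative flat ([:0, 0, 1:] * (p - pderiv p)) x) (at x)"
proof -
  let ?q = "[:0, 0, 1:] * (p - pderiv p)"
  consider "x < 0" | "x = 0" | "x > 0" by linarith
  then show ?thesis
  proof cases
    case 1
    have "((\<lambda>_. 0) has_real_derivative 0) (at x)" by simp
    then have "(flat p has_real_derivative 0) (at x)"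
      by (rule has_field_derivative_transform_within_open[where S = "{..<0}"])
        (use 1 in \<open>auto simp: flat_def\<close>)
    then show ?thesis using 1 by (simp add: flat_def)
  next
    case 2
    have "((\<lambda>u. poly (pCons 0 p) u * exp (- u)) \<longlongrightarrow> (0::real)) at_top"
      by (rule poly_times_exp_minus_tendsto_0)
    then have "((\<lambda>h. poly (pCons 0 p) (inverse h) * exp (- inverse h)) \<longlongrightarrow> (0::real)) (at_right 0)"
      by (rule filterlim_compose[OF _ filterlim_inverse_at_top_right])
    then have r: "((\<lambda>h. flat p h / h) \<longlongrightarrow> 0) (at_right 0)"
      by (rule Lim_transform_eventually)
        (auto simp: eventually_at_right_field flat_def divide_inverse intro!: exI[of _ 1])
    have l: "((\<lambda>h. flat p h / h) \<longlongrightarrow> 0) (at_left 0)"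
      by (rule Lim_transform_eventually[OF tendsto_const])
        (auto simp: eventually_at_left_field flat_def intro!: exI[of _ "-1"])
    have "((\<lambda>h. flat p h / h) \<longlongrightarrow> 0) (at 0)"
      using l r by (simp add: filterlim_split_at)
    then show ?thesis using 2 by (simp add: DERIV_def flat_def)
  next
    case 3
    have "((\<lambda>x. poly p (1 / x) * exp (- (1 / x))) has_real_derivative flat ?q x) (at x)"
      using 3 by (auto intro!: derivative_eq_intros
          simp: flat_def field_simps power2_eq_square)
    then show ?thesis
      by (rule has_field_derivative_transform_within_open[where S = "{0<..}"])
        (use 3 in \<open>auto simp: flat_def\<close>)
  qed
qed

text \<open>
  An algebra of functions that is closed under derivation; all its members are therefore smooth.
  This avoids any computation of higher derivatives of products.
\<close>

inductive_set flat_algebra :: "(real \<Rightarrow> real) set" where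
  left: "(\<lambda>x. flat p (x - l)) \<in> flat_algebra"
| right: "(\<lambda>x. flat p (r - x)) \<in> flat_algebra"
| minus: "f \<in> flat_algebra \<Longrightarrow> (\<lambda>x. - f x) \<in> flat_algebra"
| add: "f \<in> flat_algebra \<Longrightarrow> g \<in> flat_algebra \<Longrightarrow> (\<lambda>x. f x + g x) \<in> flat_algebra"
| mult: "f \<in> flat_algebra \<Longrightarrow> g \<in> flat_algebra \<Longrightarrow> (\<lambda>x. f x * g x) \<in> flat_algebra"

lemma flat_algebra_derivative:
  "f \<in> flat_algebra \<Longrightarrow> \<exists>g\<in>flat_algebra. \<forall>x. (f has_real_derivative g x) (at x)"
proof (induction rule: flat_algebra.induct)
  case (left p l)
  show ?case
    by (intro bexI[OF _ flat_algebra.left[of "[:0, 0, 1:] * (p - pderiv p)" l]] allI)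
      (auto intro!: derivative_eq_intros DERIV_chain'[OF _ flat_has_derivative, THEN DERIV_cong])
next
  case (right p r)
  show ?case
    by (intro bexI[OF _ flat_algebra.minus[OF flat_algebra.right[of "[:0, 0, 1:] * (p - pderiv p)" r]]] allI)
      (auto intro!: derivative_eq_intros DERIV_chain'[OF _ flat_has_derivative, THEN DERIV_cong])
next
  case (minus f)
  then obtain f' where "f' \<in> flat_algebra" "\<And>x. (f has_real_derivative f' x) (at x)" by blast
  then show ?case
    by (intro bexI[of _ "\<lambda>x. - f' x"] allI DERIV_minus flat_algebra.minus)
next
  case (add f g)
  then obtain f' g' where "f' \<in> flat_algebra" "\<And>x. (f has_real_derivative f' x) (at x)"
    "g' \<in> flat_algebra" "\<And>x. (g has_real_derivative g' x) (at x)" by blast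
  then show ?case
    by (intro bexI[of _ "\<lambda>x. f' x + g' x"] allI DERIV_add flat_algebra.add)
next
  case (mult f g)
  then obtain f' g' where "f' \<in> flat_algebra" "\<And>x. (f has_real_derivative f' x) (at x)"
    "g' \<in> flat_algebra" "\<And>x. (g has_real_derivative g' x) (at x)" by blast
  with mult.hyps show ?case
    by (intro bexI[of _ "\<lambda>x. f' x * g x + g' x * f x"] allI DERIV_mult flat_algebra.intros)
qed

lemma flat_algebra_deriv: "f \<in> flat_algebra \<Longrightarrow> deriv f \<in> flat_algebra"
proof -
  assume "f \<in> flat_algebra"
  then obtain g where "g \<in> flat_algebra" "\<And>x. (f has_real_derivative g x) (at x)"
    using flat_algebra_derivative by blast
  moreover from this have "deriv f = g" by (auto intro: DERIV_imp_deriv)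
  ultimately show ?thesis by simp
qed

lemma flat_algebra_smooth:
  assumes "f \<in> flat_algebra"
  shows "(deriv ^^ k) f differentiable (at t)"
proof -
  have "(deriv ^^ k) f \<in> flat_algebra"
    by (induction k) (auto simp: assms flat_algebra_deriv)
  then show ?thesis
    using flat_algebra_derivative real_differentiable_def by blast
qed

text \<open>
  A smooth function \<open>H\<close> that rises from \<open>0\<close> to a positive constant on \<open>[-e, 0]\<close>.  It is the
  antiderivative of a bump, namely the product of a flat function that vanishes left of \<open>-e\<close>
  and one that vanishes right of \<open>0\<close>.
\<close>

lemma smooth_step:
  fixes e :: real
  assumes "e > 0"
  obtains h H :: "real \<Rightarrow> real" where
    "\<And>s. (\<lambda>x. h (x - s)) \<in> flat_algebra"
    "\<And>x. (H has_real_derivative h x) (at x)"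
    "\<And>x. 0 \<le> h x" "\<And>x. x \<le> - e \<or> 0 \<le> x \<Longrightarrow> h x = 0" "\<And>x. x \<le> - e \<Longrightarrow> H x = 0" "\<And>x. 0 \<le> x \<Longrightarrow> H x = H 0" "0 < H 0"
proof -
  define h where "h = (\<lambda>x. flat 1 (x + e) * flat 1 (0 - x))"
  \<comment> \<open>Starting the integral at \<open>- e - 1\<close> makes \<open>- e\<close> an interior point for the fundamental theorem.\<close>
  define H where "H = (\<lambda>x. integral {- e - 1..x} h)"
  have alg: "(\<lambda>x. h (x - s)) \<in> flat_algebra" for s
    using flat_algebra.mult[OF flat_algebra.left[of 1 "s - e"] flat_algebra.right[of 1 s]]
    by (simp add: h_def algebra_simps)
  have h0: "0 \<le> h x" for x by (simp add: h_def flat_def)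
  have hpos: "0 < h x" if "- e < x" "x < 0" for x using that by (simp add: h_def flat_def)
  have hz: "h x = 0" if "x \<le> - e \<or> 0 \<le> x" for x using that by (auto simp: h_def flat_def)
  have "h \<in> flat_algebra" using alg[of 0] by simp
  then have cont: "continuous_on A h" for A
    by (metis flat_algebra_derivative DERIV_isCont continuous_at_imp_continuous_on)
  have H0: "H x = 0" if "x \<le> - e" for x
  proof -
    have "H x = integral {- e - 1..x} (\<lambda>_. 0)"
      unfolding H_def by (rule integral_cong) (use that hz in auto)
    then show ?thesis by simp
  qed
  have deriv: "(H has_real_derivative h x) (at x)" for x
  proof (cases "x < - e")
    case True
    have "((\<lambda>_. 0) has_real_derivative 0) (at x)" by simp
    then have "(H has_real_derivative 0) (at x)"
      by (rule has_field_derivative_transform_within_open[where S = "{..<- e}"])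
        (use True H0 in auto)
    then show ?thesis using True hz by simp
  next
    case False
    have "(H has_real_derivative h x) (at x within {- e - 1..x + 1})"
      unfolding H_def by (rule integral_has_real_derivative) (use False cont in auto)
    then show ?thesis
      using False by (simp add: at_within_Icc_at)
  qed
  have const: "H x = H 0" if "0 \<le> x" for x
  proof (cases "x = 0")
    case False
    have "\<exists>z. 0 < z \<and> z < x \<and> H x - H 0 = (x - 0) * h z"
      by (rule MVT2) (use that False deriv in auto)
    then show ?thesis using hz by auto
  qed simp
  have "\<exists>z. - e < z \<and> z < 0 \<and> H 0 - H (- e) = (0 - - e) * h z"
    by (rule MVT2) (use assms deriv in auto)
  then have "0 < H 0" using H0[of "- e"] hpos assms by auto
  then show thesis by (intro that[of h H] alg deriv h0 hz H0 const)
qed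

section \<open>Distributions with vanishing derivative\<close>

text \<open>
  A Henstock--Kurzweil integrable function may be multiplied by a monotone one (second mean
  value theorem), and a \<open>C\<^sup>1\<close> function is the difference of two monotone functions:
  \<open>\<psi>(x) = (\<psi>(x) + K x) - K x\<close> with \<open>K\<close> a bound of \<open>|\<psi>'|\<close>.
\<close>

lemma integrable_mult_C1:
  fixes f \<psi> :: "real \<Rightarrow> real"
  assumes f: "f integrable_on {s..t}"
    and \<psi>: "\<And>x. (\<psi> has_real_derivative \<psi>' x) (at x)"
    and cont: "continuous_on {s..t} \<psi>'"
  shows "(\<lambda>x. f x * \<psi> x) integrable_on {s..t}"
proof (cases "s \<le> t")
  case True
  have "bounded (\<psi>' ` {s..t})"
    using cont by (intro compact_imp_bounded compact_continuous_image) auto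
  then obtain K where K: "K > 0" "\<And>x. x \<in> {s..t} \<Longrightarrow> \<bar>\<psi>' x\<bar> \<le> K"
    by (auto simp: bounded_pos)
  have "\<psi> x + K * x \<le> \<psi> y + K * y" if "s \<le> x" "x \<le> y" "y \<le> t" for x y
  proof (rule DERIV_nonneg_imp_nondecreasing[OF \<open>x \<le> y\<close>])
    fix z assume "x \<le> z" "z \<le> y"
    then have "0 \<le> \<psi>' z + K" using K(2)[of z] that by auto
    moreover have "((\<lambda>x. \<psi> x + K * x) has_real_derivative \<psi>' z + K) (at z)"
      by (auto intro!: derivative_eq_intros \<psi>)
    ultimately show "\<exists>d. ((\<lambda>x. \<psi> x + K * x) has_real_derivative d) (at z) \<and> 0 \<le> d" by blast
  qed
  then have 1: "(\<lambda>x. (\<psi> x + K * x) * f x) integrable_on {s..t}"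
    using second_mean_value_theorem_full[OF f True, of "\<lambda>x. \<psi> x + K * x"] by (meson has_integral_integrable)
  have 2: "(\<lambda>x. (K * x) * f x) integrable_on {s..t}"
    using second_mean_value_theorem_full[OF f True, of "\<lambda>x. K * x"] K(1)
    by (meson has_integral_integrable mult_left_mono less_imp_le)
  show ?thesis using integrable_diff[OF 1 2] by (simp add: algebra_simps)
qed (simp add: integrable_on_empty)

lemma Ico_Icc_subset: "x \<in> Ico a b \<Longrightarrow> {a..x} \<subseteq> Ico a b"
proof
  fix y assume x: "x \<in> Ico a b" and y: "y \<in> {a..x}"
  then have "ereal y \<le> ereal x" "ereal x < b" by (simp_all add: Ico_def)
  then have "ereal y < b" by (rule le_less_trans)
  then show "y \<in> Ico a b" using y by (simp add: Ico_def)
qed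

lemma test_function_has_derivative:
  "\<phi> \<in> test_functions a b \<Longrightarrow> (\<phi> has_real_derivative deriv \<phi> x) (at x)"
proof -
  assume "\<phi> \<in> test_functions a b"
  then have "(deriv ^^ 0) \<phi> differentiable (at x)" unfolding test_functions_def by blast
  then show ?thesis by (simp add: DERIV_deriv_iff_real_differentiable)
qed

lemma test_function_eq_0: "x \<notin> support \<phi> \<Longrightarrow> \<phi> x = 0"
  unfolding support_def using closure_subset[of "{t. \<phi> t \<noteq> 0}"] by blast

lemma closed_support: "closed (support \<phi>)"
  by (simp add: support_def)

lemma support_deriv_subset: "support (deriv \<phi>) \<subseteq> support \<phi>"
proof -
  have "deriv \<phi> x = 0" if "x \<notin> support \<phi>" for x
  proof (rule DERIV_imp_deriv)
    have "((\<lambda>_. 0) has_real_derivative 0) (at x)" by simp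
    then show "(\<phi> has_real_derivative 0) (at x)"
      by (rule has_field_derivative_transform_within_open[where S = "- support \<phi>"])
        (use that in \<open>simp_all add: test_function_eq_0[of _ \<phi>] open_Compl closed_support\<close>)
  qed
  then have "{x. deriv \<phi> x \<noteq> 0} \<subseteq> support \<phi>" by blast
  then show ?thesis
    unfolding support_def[of "deriv \<phi>"] by (rule closure_minimal) (rule closed_support)
qed

lemma test_function_deriv:
  assumes "\<phi> \<in> test_functions a b"
  shows "deriv \<phi> \<in> test_functions a b"
proof -
  have "(deriv ^^ k) (deriv \<phi>) differentiable (at t)" for k t
  proof -
    have "(deriv ^^ Suc k) \<phi> differentiable (at t)"
      using assms unfolding test_functions_def by blast
    then show ?thesis by (simp only: funpow_Suc_right comp_apply)
  qed
  moreover have "compact (support (deriv \<phi>))"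
    unfolding compact_eq_bounded_closed
  proof
    have "bounded (support \<phi>)" using assms by (simp add: test_functions_def compact_imp_bounded)
    then show "bounded (support (deriv \<phi>))" using support_deriv_subset by (rule bounded_subset)
  qed (rule closed_support)
  ultimately show ?thesis
    using assms order_trans[OF support_deriv_subset[of \<phi>], of "Ico a b"] by (simp add: test_functions_def)
qed

lemma test_function_support_bound:
  assumes "ereal a < b" "\<phi> \<in> test_functions a b"
  obtains d where "d \<in> Ico a b" "\<And>x. x \<notin> {a..d} \<Longrightarrow> \<phi> x = 0"
proof (cases "support \<phi> = {}")
  case True
  have "\<phi> x = 0" for x by (rule test_function_eq_0[of x \<phi>]) (simp add: True)
  moreover have "a \<in> Ico a b" using assms(1) by (simp add: Ico_def)
  ultimately show thesis using that by blast
next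
  case False
  have K: "compact (support \<phi>)" "support \<phi> \<subseteq> Ico a b"
    using assms(2) by (auto simp: test_functions_def)
  obtain d where d: "d \<in> support \<phi>" "\<And>x. x \<in> support \<phi> \<Longrightarrow> x \<le> d"
    using compact_attains_sup[OF K(1) False] by blast
  have "\<phi> x = 0" if "x \<notin> {a..d}" for x
  proof (rule test_function_eq_0[of x \<phi>])
    show "x \<notin> support \<phi>" using that d(2) K(2) by (auto simp: Ico_def)
  qed
  then show thesis using that d(1) K(2) by blast
qed

lemma integrable_mult_test_function:
  assumes "ereal a < b" and H: "\<And>d. d \<in> Ico a b \<Longrightarrow> H integrable_on {a..d}"
    and \<phi>: "\<phi> \<in> test_functions a b"
  shows "(\<lambda>t. H t * \<phi> t) integrable_on Ico a b"
proof -
  obtain d where d: "d \<in> Ico a b" "\<And>x. x \<notin> {a..d} \<Longrightarrow> \<phi> x = 0"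
    using test_function_support_bound[OF assms(1) \<phi>] by blast
  have "continuous_on {a..d} (deriv \<phi>)"
    using test_function_has_derivative[OF test_function_deriv[OF \<phi>]]
    by (auto intro!: continuous_at_imp_continuous_on dest: DERIV_isCont)
  then have "(\<lambda>t. H t * \<phi> t) integrable_on {a..d}"
    using H[OF d(1)] test_function_has_derivative[OF \<phi>] by (rule integrable_mult_C1[rotated 2])
  then show ?thesis
    using has_integral_on_superset[OF _ _ Ico_Icc_subset[OF d(1)]] d(2)
    by (metis (no_types, lifting) integrable_on_def mult_zero_right)
qed

lemma has_derivative_translate:
  fixes H :: "real \<Rightarrow> real"
  assumes "\<And>x. (H has_real_derivative h x) (at x)"
  shows "((\<lambda>x. H (x - s)) has_real_derivative h (x - s)) (at x)"
  using DERIV_shift[of H "h (x - s)" x "- s"] assms by simp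

text \<open>
  The number \<open>I\<close> is an average of \<open>D\<close> over \<open>[s - e, s]\<close> with the nonnegative weight \<open>h(x - s)\<close>
  of total mass \<open>H 0 - H (- e)\<close>, so it is close to \<open>D s\<close> times this mass.
\<close>

lemma left_average_estimate:
  fixes D :: "real \<Rightarrow> real"
  assumes I: "((\<lambda>x. D x * h (x - s)) has_integral I) {s - e..s}"
    and H: "\<And>x. (H has_real_derivative h x) (at x)" and h: "\<And>x. 0 \<le> h x" and "e > 0"
    and near: "\<And>x. x \<in> {s - e..s} \<Longrightarrow> \<bar>D x - D s\<bar> \<le> \<eta>"
  shows "\<bar>I - D s * (H 0 - H (- e))\<bar> \<le> \<eta> * (H 0 - H (- e))"
proof -
  let ?J = "H 0 - H (- e)"
  have "((\<lambda>x. H (x - s)) has_vector_derivative h (x - s)) (at x within {s - e..s})" for x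
    unfolding has_real_derivative_iff_has_vector_derivative[symmetric]
    by (rule has_field_derivative_at_within[OF has_derivative_translate[OF H]])
  then have J: "((\<lambda>x. h (x - s)) has_integral ?J) {s - e..s}"
    using fundamental_theorem_of_calculus[of "s - e" s "\<lambda>x. H (x - s)"] \<open>e > 0\<close> by simp
  have n: "D s - \<eta> \<le> D x \<and> D x \<le> D s + \<eta>" if "x \<in> {s - e..s}" for x
    using near[OF that] by linarith
  have "(D s - \<eta>) * ?J \<le> I"
    by (rule has_integral_le[OF has_integral_mult_right[OF J] I])
      (use n h in \<open>auto intro!: mult_right_mono\<close>)
  moreover have "I \<le> (D s + \<eta>) * ?J"
    by (rule has_integral_le[OF I has_integral_mult_right[OF J]])
      (use n h in \<open>auto intro!: mult_right_mono\<close>)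
  ultimately show ?thesis by (simp add: algebra_simps abs_le_iff)
qed

text \<open>
  The function \<open>\<phi>(x) = H(x - s) - H(x - t)\<close> vanishes to the left of \<open>s - e\<close> and, because the two
  plateaus cancel, to the right of \<open>t\<close>.  It is therefore a test function, and its derivative compares
  the averages of \<open>D\<close> just before \<open>s\<close> and just before \<open>t\<close>.
\<close>

lemma left_values_equal:
  assumes int: "\<And>d. d \<in> Ico a b \<Longrightarrow> D integrable_on {a..d}"
    and weak: "\<And>\<phi>. \<phi> \<in> test_functions a b \<Longrightarrow> integral (Ico a b) (\<lambda>x. D x * deriv \<phi> x) = 0"
    and "a < s" "s < t" "ereal t < b"
    and s: "continuous (at_left s) D" and t: "continuous (at_left t) D"
  shows "D s = D t"
proof -
  have "\<bar>D s - D t\<bar> \<le> \<epsilon>" if "\<epsilon> > 0" for \<epsilon>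
  proof -
    define \<eta> where "\<eta> = \<epsilon> / 2"
    have "\<eta> > 0" using that by (simp add: \<eta>_def)
    have near: "\<exists>e>0. e \<le> p - a \<and> (\<forall>x\<in>{p - e..p}. \<bar>D x - D p\<bar> \<le> \<eta>)"
      if "a < p" "continuous (at_left p) D" for p
    proof -
      have "eventually (\<lambda>x. dist (D x) (D p) < \<eta>) (at_left p)"
        using that(2) \<open>\<eta> > 0\<close> unfolding continuous_within by (rule tendstoD)
      then obtain q where q: "q < p" "\<And>y. q < y \<Longrightarrow> y < p \<Longrightarrow> dist (D y) (D p) < \<eta>"
        unfolding eventually_at_left_field by blast
      show ?thesis
      \<comment> \<open>The first entry keeps \<open>[p - e, p]\<close> in the domain, the half keeps it strictly to the right of \<open>q\<close>.\<close>
      proof (intro exI[of _ "min (p - a) ((p - q) / 2)"] conjI ballI)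
        fix x assume x: "x \<in> {p - min (p - a) ((p - q) / 2)..p}"
        then have "q < x" using q(1) by (auto simp: min_def field_simps split: if_splits)
        then show "\<bar>D x - D p\<bar> \<le> \<eta>"
          using q(2)[of x] x \<open>\<eta> > 0\<close> by (cases "x = p") (auto simp: dist_real_def)
      qed (use q(1) \<open>a < p\<close> in auto)
    qed
    obtain e1 where e1: "e1 > 0" "e1 \<le> s - a" "\<And>x. x \<in> {s - e1..s} \<Longrightarrow> \<bar>D x - D s\<bar> \<le> \<eta>"
      using near[OF \<open>a < s\<close> s] by blast
    obtain e2 where e2: "e2 > 0" "e2 \<le> t - a" "\<And>x. x \<in> {t - e2..t} \<Longrightarrow> \<bar>D x - D t\<bar> \<le> \<eta>"
      using near[OF _ t] \<open>a < s\<close> \<open>s < t\<close> by force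
    define e where "e = min e1 e2"
    have e: "e > 0" "e \<le> s - a" "e \<le> t - a" using e1 e2 by (auto simp: e_def)
    obtain h H where hH: "\<And>s. (\<lambda>x. h (x - s)) \<in> flat_algebra"
      "\<And>x. (H has_real_derivative h x) (at x)"
      "\<And>x. 0 \<le> h x" "\<And>x. x \<le> - e \<or> 0 \<le> x \<Longrightarrow> h x = 0" "\<And>x. x \<le> - e \<Longrightarrow> H x = 0"
      "\<And>x. 0 \<le> x \<Longrightarrow> H x = H 0" "0 < H 0"
      using smooth_step[OF e(1)] by blast
    define \<rho> where "\<rho> = (\<lambda>x. h (x - s) - h (x - t))"
    define \<phi> where "\<phi> = (\<lambda>x. H (x - s) - H (x - t))"
    have \<rho>: "\<rho> \<in> flat_algebra"
      using flat_algebra.add[OF hH(1)[of s] flat_algebra.minus[OF hH(1)[of t]]] by (simp add: \<rho>_def)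
    have d\<phi>: "(\<phi> has_real_derivative \<rho> x) (at x)" for x
      unfolding \<phi>_def \<rho>_def
      by (intro DERIV_diff has_derivative_translate hH(2))
    then have deriv\<phi>: "deriv \<phi> = \<rho>" by (auto intro: DERIV_imp_deriv)
    have "\<phi> x = 0" if "x \<notin> {s - e..t}" for x
      using that hH(5)[of "x - s"] hH(5)[of "x - t"] hH(6)[of "x - s"] hH(6)[of "x - t"] \<open>s < t\<close>
      by (cases "x < s - e") (auto simp: \<phi>_def)
    then have "{x. \<phi> x \<noteq> 0} \<subseteq> {s - e..t}" by blast
    then have supp: "support \<phi> \<subseteq> {s - e..t}"
      unfolding support_def by (rule closure_minimal) simp
    have "t \<in> Ico a b" using \<open>a < s\<close> \<open>s < t\<close> \<open>ereal t < b\<close> by (simp add: Ico_def)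
    have sub: "{a..t} \<subseteq> Ico a b" by (rule Ico_Icc_subset) fact
    have test: "\<phi> \<in> test_functions a b"
      unfolding test_functions_def
    proof (intro CollectI conjI allI)
      show "(deriv ^^ k) \<phi> differentiable (at x)" for k x
      proof (cases k)
        case 0
        then show ?thesis using d\<phi> real_differentiable_def by auto
      next
        case (Suc n)
        then show ?thesis using flat_algebra_smooth[OF \<rho>, of n]
          by (simp only: funpow_Suc_right comp_apply deriv\<phi>)
      qed
      have "bounded (support \<phi>)" using supp bounded_closed_interval bounded_subset by blast
      then show "compact (support \<phi>)" by (simp add: compact_eq_bounded_closed closed_support)
      show "support \<phi> \<subseteq> Ico a b" using supp sub e by force
    qed
    have ints: "\<exists>I. ((\<lambda>x. D x * h (x - p)) has_integral I) {p - e..p}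
        \<and> ((\<lambda>x. D x * h (x - p)) has_integral I) (Ico a b)" if "e \<le> p - a" "p \<le> t" for p
    proof -
      have subp: "{p - e..p} \<subseteq> {a..t}" using that by auto
      obtain h' where "h' \<in> flat_algebra" "\<And>x. ((\<lambda>x. h (x - p)) has_real_derivative h' x) (at x)"
        using flat_algebra_derivative[OF hH(1)] by blast
      moreover obtain h'' where "\<And>x. (h' has_real_derivative h'' x) (at x)"
        using flat_algebra_derivative[OF \<open>h' \<in> flat_algebra\<close>] by blast
      then have "continuous_on {p - e..p} h'"
        by (meson DERIV_isCont continuous_at_imp_continuous_on)
      moreover have "D integrable_on {p - e..p}"
        using int[OF \<open>t \<in> Ico a b\<close>] subp by (rule integrable_on_subinterval)
      ultimately have "(\<lambda>x. D x * h (x - p)) integrable_on {p - e..p}"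
        by (intro integrable_mult_C1) auto
      then obtain I where I: "((\<lambda>x. D x * h (x - p)) has_integral I) {p - e..p}" by blast
      moreover have "((\<lambda>x. D x * h (x - p)) has_integral I) (Ico a b)"
        by (rule has_integral_on_superset[OF I]) (use hH(4)[of "_ - p"] subp sub in auto)
      ultimately show ?thesis by blast
    qed
    obtain I1 where I1: "((\<lambda>x. D x * h (x - s)) has_integral I1) {s - e..s}"
        "((\<lambda>x. D x * h (x - s)) has_integral I1) (Ico a b)" using ints[of s] e \<open>s < t\<close> by auto
    obtain I2 where I2: "((\<lambda>x. D x * h (x - t)) has_integral I2) {t - e..t}"
        "((\<lambda>x. D x * h (x - t)) has_integral I2) (Ico a b)" using ints[of t] e by auto
    have "((\<lambda>x. D x * deriv \<phi> x) has_integral I1 - I2) (Ico a b)"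
      using has_integral_diff[OF I1(2) I2(2)] by (simp add: deriv\<phi> \<rho>_def algebra_simps)
    then have "I1 = I2" using weak[OF test] by (simp add: integral_unique)
    have H0: "H (- e) = 0" using hH(5) by simp
    have "\<bar>I1 - D s * (H 0 - H (- e))\<bar> \<le> \<eta> * (H 0 - H (- e))"
      by (rule left_average_estimate[OF I1(1) hH(2,3) e(1)]) (use e1 e_def in auto)
    moreover have "\<bar>I2 - D t * (H 0 - H (- e))\<bar> \<le> \<eta> * (H 0 - H (- e))"
      by (rule left_average_estimate[OF I2(1) hH(2,3) e(1)]) (use e2 e_def in auto)
    moreover have "\<bar>x - y\<bar> \<le> \<bar>z - x\<bar> + \<bar>z - y\<bar>" for x y z :: real by linarith
    ultimately have "\<bar>D s * H 0 - D t * H 0\<bar> \<le> 2 * (\<eta> * H 0)"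
      using \<open>I1 = I2\<close> H0 by (smt (verit))
    then have "\<bar>D s * H 0 - D t * H 0\<bar> \<le> \<epsilon> * H 0" by (simp add: \<eta>_def)
    then have "\<bar>D s - D t\<bar> * H 0 \<le> \<epsilon> * H 0"
      using hH(7) by (metis abs_mult abs_of_pos left_diff_distrib)
    then show ?thesis using hH(7) by simp
  qed
  then have "\<bar>D s - D t\<bar> \<le> 0" by (rule field_le_epsilon) simp
  then show ?thesis by simp
qed

lemma eventually_at_right_Ico: "ereal a < b \<Longrightarrow> eventually (\<lambda>x. a < x \<and> ereal x < b) (at_right a)"
proof -
  assume "ereal a < b"
  then obtain d where d: "a < d" "ereal d < b" using ereal_dense2[of "ereal a" b] by auto
  then show ?thesis
    unfolding eventually_at_right_field
    by (intro exI[of _ d]) (auto intro: less_trans[where y = "ereal d"])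
qed

lemma constant_if_weak_derivative_0:
  assumes "ereal a < b"
    and int: "\<And>d. d \<in> Ico a b \<Longrightarrow> D integrable_on {a..d}"
    and weak: "\<And>\<phi>. \<phi> \<in> test_functions a b \<Longrightarrow> integral (Ico a b) (\<lambda>x. D x * deriv \<phi> x) = 0"
    and right: "continuous (at_right a) D"
    and left: "\<And>t. a < t \<Longrightarrow> ereal t < b \<Longrightarrow> continuous (at_left t) D"
    and x: "x \<in> Ico a b"
  shows "D x = D a"
proof (cases "x = a")
  case False
  then have x': "a < x" "ereal x < b" using x by (auto simp: Ico_def)
  have "D y = D x" if "a < y" "ereal y < b" for y
    using left_values_equal[OF int weak _ _ _ left left] that x' by (metis linorder_neqE)
  then have "eventually (\<lambda>y. D y = D x) (at_right a)"
    using eventually_at_right_Ico[OF assms(1)] by (auto elim: eventually_mono)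
  then have "(D \<longlongrightarrow> D x) (at_right a)" by (rule tendsto_eventually)
  moreover have "(D \<longlongrightarrow> D a) (at_right a)" using right by (simp add: continuous_within)
  ultimately show ?thesis using tendsto_unique trivial_limit_at_right_real by blast
qed simp

section \<open>Primitives\<close>

lemma locally_HK_integrable: "H \<in> locally_HK a b \<Longrightarrow> d \<in> Ico a b \<Longrightarrow> H integrable_on {a..d}"
  using Ico_Icc_subset by (simp add: locally_HK_def)

lemma dist_deriv_of_fun:
  "\<phi> \<in> test_functions a b \<Longrightarrow>
    dist_deriv a b (dist_of_fun a b F) \<phi> = - integral (Ico a b) (\<lambda>x. F x * deriv \<phi> x)"
  by (simp add: dist_deriv_def dist_of_fun_def test_function_deriv)

text \<open>
  Both products with \<open>deriv \<phi>\<close> are integrable, so the two integrals may be subtracted and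
  \<open>F - G\<close> has weak derivative zero.
\<close>

lemma primitive_unique:
  assumes "ereal a < b" and F: "F \<in> Dlc a b" and G: "G \<in> Dlc a b"
    and eq: "dist_deriv a b (dist_of_fun a b F) = dist_deriv a b (dist_of_fun a b G)"
    and x: "x \<in> Ico a b"
  shows "F x - F a = G x - G a"
proof -
  have F': "F \<in> locally_HK a b" and G': "G \<in> locally_HK a b" using F G by (auto simp: Dlc_def)
  have "F x - G x = F a - G a"
  proof (rule constant_if_weak_derivative_0[OF assms(1), of "\<lambda>x. F x - G x"])
    show "(\<lambda>x. F x - G x) integrable_on {a..d}" if "d \<in> Ico a b" for d
      using that F' G' by (intro integrable_diff locally_HK_integrable)
    show "integral (Ico a b) (\<lambda>x. (F x - G x) * deriv \<phi> x) = 0"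
      if \<phi>: "\<phi> \<in> test_functions a b" for \<phi>
    proof -
      have "(\<lambda>x. H x * deriv \<phi> x) integrable_on Ico a b" if "H \<in> locally_HK a b" for H
        using that by (intro integrable_mult_test_function assms(1) test_function_deriv \<phi> locally_HK_integrable)
      then show ?thesis
        using F' G' fun_cong[OF eq, of \<phi>] \<phi>
        by (simp add: left_diff_distrib Henstock_Kurzweil_Integration.integral_diff dist_deriv_of_fun)
    qed
  qed (use F G x in \<open>auto simp: Dlc_def intro!: continuous_intros\<close>)
  then show ?thesis by simp
qed

lemma dist_integral_deriv:
  assumes "ereal a < b" "F \<in> Dlc a b" "x \<in> Ico a b"
  shows "dist_integral a b (dist_deriv a b (dist_of_fun a b F)) x = F x - F a"
  unfolding dist_integral_def
proof (rule the_equality)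
  fix r
  assume "\<exists>G\<in>Dlc a b. dist_deriv a b (dist_of_fun a b F) = dist_deriv a b (dist_of_fun a b G) \<and> r = G x - G a"
  then show "r = F x - F a" using primitive_unique[OF assms(1,2) _ _ assms(3)] by metis
qed (use assms(2) in blast)

definition primitive :: "real \<Rightarrow> ereal \<Rightarrow> real \<Rightarrow> dist \<Rightarrow> real \<Rightarrow> real" where
  "primitive a b c g = (\<lambda>x\<in>Ico a b. c + dist_integral a b g x)"

text \<open>
  The fundamental theorem applies on any interval with the support in its interior.  In other words,
  constants have distributional derivative zero, so the value of a primitive at \<open>a\<close> is free.
\<close>

lemma integral_deriv_test_function:
  assumes "ereal a < b" and \<phi>: "\<phi> \<in> test_functions a b"
  shows "integral (Ico a b) (deriv \<phi>) = 0"
proof -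
  obtain d where d: "d \<in> Ico a b" "\<And>x. x \<notin> {a..d} \<Longrightarrow> \<phi> x = 0"
    using test_function_support_bound[OF assms] by blast
  obtain d' where d': "d' \<in> Ico a b" "\<And>x. x \<notin> {a..d'} \<Longrightarrow> deriv \<phi> x = 0"
    using test_function_support_bound[OF assms(1) test_function_deriv[OF \<phi>]] by blast
  define r where "r = max d d' + 1"
  have "a \<le> d" "a \<le> d'" using d(1) d'(1) by (auto simp: Ico_def)
  have "(deriv \<phi> has_integral (\<phi> r - \<phi> (a - 1))) {a - 1..r}"
    using test_function_has_derivative[OF \<phi>] \<open>a \<le> d\<close>
    by (intro fundamental_theorem_of_calculus)
      (auto simp: r_def has_real_derivative_iff_has_vector_derivative[symmetric]
         intro: has_field_derivative_at_within)
  then have "(deriv \<phi> has_integral 0) {a - 1..r}" using d(2)[of r] d(2)[of "a - 1"] by (auto simp: r_def max_def split: if_splits)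
  then have "(deriv \<phi> has_integral 0) UNIV"
    by (rule has_integral_on_superset) (use d'(2) \<open>a \<le> d'\<close> in \<open>force simp: r_def\<close>)+
  then have "((\<lambda>x. if x \<in> Ico a b then deriv \<phi> x else 0) has_integral 0) UNIV"
    by (rule has_integral_eq[rotated]) (use d'(2) Ico_Icc_subset[OF d'(1)] in \<open>metis subsetD\<close>)
  then show ?thesis by (simp add: has_integral_restrict_UNIV integral_unique)
qed

lemma
  assumes ab: "ereal a < b" and "g \<in> A_D a b"
  shows primitive_in_Dlc: "primitive a b c g \<in> Dlc a b"
    and primitive_at_left_end: "primitive a b c g a = c"
    and dist_deriv_primitive: "dist_deriv a b (dist_of_fun a b (primitive a b c g)) = g"
proof -
  obtain F where F: "F \<in> Dlc a b" and g: "g = dist_deriv a b (dist_of_fun a b F)"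
    using assms(2) by (auto simp: A_D_def)
  define k where "k = c - F a"
  have P: "primitive a b c g = (\<lambda>x\<in>Ico a b. F x + k)"
    using dist_integral_deriv[OF ab F] by (auto simp: primitive_def g k_def)
  have F': "F \<in> locally_HK a b" using F by (auto simp: Dlc_def)
  have a: "a \<in> Ico a b" using ab by (simp add: Ico_def)
  then show "primitive a b c g a = c" by (simp add: P k_def)
  show "primitive a b c g \<in> Dlc a b"
    unfolding P Dlc_def
  proof (intro CollectI conjI allI impI)
    show "(\<lambda>x\<in>Ico a b. F x + k) \<in> locally_HK a b"
      unfolding locally_HK_def
    proof (intro CollectI conjI allI impI)
      fix s t assume st: "{s..t} \<subseteq> Ico a b"
      then have "(\<lambda>x. F x + k) integrable_on {s..t}"
        using F' by (intro integrable_add) (auto simp: locally_HK_def)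
      then show "(\<lambda>x\<in>Ico a b. F x + k) integrable_on {s..t}"
        by (rule integrable_eq) (use st in auto)
    qed simp
    have "(F \<longlongrightarrow> F a) (at_right a)" using F by (simp add: Dlc_def continuous_within)
    then have "((\<lambda>x. F x + k) \<longlongrightarrow> F a + k) (at_right a)" by (intro tendsto_intros)
    then have "((\<lambda>x\<in>Ico a b. F x + k) \<longlongrightarrow> F a + k) (at_right a)"
      by (rule Lim_transform_eventually)
        (use eventually_at_right_Ico[OF ab] in \<open>auto elim!: eventually_mono simp: Ico_def\<close>)
    then show "continuous (at_right a) (\<lambda>x\<in>Ico a b. F x + k)"
      using a by (simp add: continuous_within)
  next
    fix t assume t: "a < t \<and> ereal t < b"
    have tI: "t \<in> Ico a b" using t by (simp add: Ico_def)
    have "(F \<longlongrightarrow> F t) (at_left t)" using F t by (simp add: Dlc_def continuous_within)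
    then have "((\<lambda>x. F x + k) \<longlongrightarrow> F t + k) (at_left t)" by (intro tendsto_intros)
    moreover have "eventually (\<lambda>x. x \<in> Ico a b) (at_left t)"
      using t Ico_Icc_subset[OF tI] unfolding eventually_at_left_field
      by (intro exI[of _ a]) auto
    ultimately have "((\<lambda>x\<in>Ico a b. F x + k) \<longlongrightarrow> F t + k) (at_left t)"
      by (elim Lim_transform_eventually) (auto elim!: eventually_mono)
    then show "continuous (at_left t) (\<lambda>x\<in>Ico a b. F x + k)"
      using tI by (simp add: continuous_within)
  qed
  show "dist_deriv a b (dist_of_fun a b (primitive a b c g)) = g"
  proof
    fix \<phi>
    show "dist_deriv a b (dist_of_fun a b (primitive a b c g)) \<phi> = g \<phi>"
    proof (cases "\<phi> \<in> test_functions a b")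
      case True
      let ?I = "integral (Ico a b)"
      note \<phi>' = test_function_deriv[OF True]
      have "?I (\<lambda>x. primitive a b c g x * deriv \<phi> x) = ?I (\<lambda>x. F x * deriv \<phi> x + k * deriv \<phi> x)"
        by (rule integral_cong) (simp add: P algebra_simps)
      also have "\<dots> = ?I (\<lambda>x. F x * deriv \<phi> x) + ?I (\<lambda>x. k * deriv \<phi> x)"
        by (intro Henstock_Kurzweil_Integration.integral_add integrable_mult_test_function ab \<phi>' locally_HK_integrable[OF F'])
          (auto intro: integrable_const_ivl)
      also have "?I (\<lambda>x. k * deriv \<phi> x) = 0"
        using integral_deriv_test_function[OF ab True] by simp
      finally show ?thesis using True by (simp add: g dist_deriv_of_fun)
    qed (simp add: g dist_deriv_def)
  qed
qed

section \<open>Essential infima\<close>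

lemma sigma_finite_completion:
  assumes "sigma_finite_measure M"
  shows "sigma_finite_measure (completion M)"
proof
  interpret sigma_finite_measure M by fact
  obtain A where "countable A" "A \<subseteq> sets M" "\<Union>A = space M" "\<forall>a\<in>A. emeasure M a \<noteq> \<infinity>"
    using sigma_finite_countable by auto
  then show "\<exists>A. countable A \<and> A \<subseteq> sets (completion M) \<and> \<Union>A = space (completion M) \<and>
      (\<forall>a\<in>A. emeasure (completion M) a \<noteq> \<infinity>)"
    by (intro exI[of _ A]) (auto simp: subset_iff)
qed

text \<open>
  Weight the functions by a positive integrable \<open>w\<close> and choose a countable subfamily \<open>C\<close> for which
  the integral of the infimum is as small as possible.  Adding one more member \<open>z\<close> to \<open>C\<close> cannot
  decrease this integral, so it does not change the infimum a.e., which means that \<open>z\<close> lies above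
  the infimum of \<open>C\<close> a.e.
\<close>

lemma (in sigma_finite_measure) essential_infimum_bounded:
  fixes S :: "('a \<Rightarrow> real) set"
  assumes meas: "\<And>z. z \<in> S \<Longrightarrow> z \<in> borel_measurable M"
    and bound: "\<And>z x. z \<in> S \<Longrightarrow> \<bar>z x\<bar> \<le> B"
    and "S \<noteq> {}"
  obtains C where "countable C" "C \<subseteq> S" "C \<noteq> {}"
    "\<And>z. z \<in> S \<Longrightarrow> AE x in M. (INF c\<in>C. c x) \<le> z x"
proof -
  obtain w :: "'a \<Rightarrow> real" where w: "w \<in> borel_measurable M" "\<And>x. w x > 0" "integrable M w"
    using obtain_positive_integrable_function by metis
  define \<C> where "\<C> = {C. countable C \<and> C \<subseteq> S \<and> C \<noteq> {}}"
  define m where "m = (\<lambda>C (x::'a). INF c\<in>C. c x :: real)"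
  define \<Phi> where "\<Phi> = (\<lambda>C. \<integral>x. m C x * w x \<partial>M)"
  have bdd: "bdd_below ((\<lambda>c. c x) ` C)" if "C \<subseteq> S" for C x
  proof (rule bdd_belowI2)
    show "- B \<le> c x" if "c \<in> C" for c
      using bound[of c x] that \<open>C \<subseteq> S\<close> by force
  qed
  have bm: "\<bar>m C x\<bar> \<le> B" if "C \<in> \<C>" for C x
    unfolding m_def using that bound by (intro cInf_abs_ge) (auto simp: \<C>_def)
  have mm: "m C \<in> borel_measurable M" if "C \<in> \<C>" for C
    unfolding m_def using that meas by (intro borel_measurable_cINF_real) (auto simp: \<C>_def)
  have int: "integrable M (\<lambda>x. m C x * w x)" if C: "C \<in> \<C>" for C
  proof (rule Bochner_Integration.integrable_bound)
    show "integrable M (\<lambda>x. B * w x)" using w by simp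
    show "AE x in M. norm (m C x * w x) \<le> norm (B * w x)"
      using bm[OF C] by (intro AE_I2) (force simp: abs_mult intro: mult_right_mono order_trans[OF _ abs_ge_self])
  qed (use mm[OF C] w in measurable)
  have anti: "m D x \<le> m C x" if "C \<in> \<C>" "D \<in> \<C>" "C \<subseteq> D" for C D x
    unfolding m_def using that bdd[of D x] by (intro cINF_superset_mono) (auto simp: \<C>_def)
  have \<Phi>_anti: "\<Phi> D \<le> \<Phi> C" if "C \<in> \<C>" "D \<in> \<C>" "C \<subseteq> D" for C D
    unfolding \<Phi>_def
    by (rule integral_mono[OF int int]) (use that anti w(2) in \<open>auto intro!: mult_right_mono less_imp_le\<close>)
  obtain z0 where "z0 \<in> S" using \<open>S \<noteq> {}\<close> by blast
  then have "{z0} \<in> \<C>" by (simp add: \<C>_def)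
  then have \<C>_ne: "\<C> \<noteq> {}" by blast
  have \<Phi>_bdd: "bdd_below (\<Phi> ` \<C>)"
  proof (rule bdd_belowI2)
    fix C assume C: "C \<in> \<C>"
    show "(\<integral>x. - B * w x \<partial>M) \<le> \<Phi> C"
      unfolding \<Phi>_def
    proof (rule integral_mono)
      fix x show "- B * w x \<le> m C x * w x"
        using bm[OF C, of x] w(2)[of x] by (intro mult_right_mono) auto
    qed (use w int[OF C] in auto)
  qed
  define \<alpha> where "\<alpha> = (INF C\<in>\<C>. \<Phi> C)"
  have "\<exists>C\<in>\<C>. \<Phi> C < \<alpha> + 1 / Suc n" for n
    using cINF_less_iff[OF \<C>_ne \<Phi>_bdd, of "\<alpha> + 1 / Suc n"] by (simp add: \<alpha>_def)
  then obtain Cn where Cn: "\<And>n. Cn n \<in> \<C>" "\<And>n. \<Phi> (Cn n) < \<alpha> + 1 / Suc n" by metis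
  \<comment> \<open>A countable union of countable families, so the minimum over countable subfamilies is attained.\<close>
  define C where "C = (\<Union>n. Cn n)"
  have C: "C \<in> \<C>" using Cn(1) by (auto simp: C_def \<C>_def)
  have "\<Phi> C \<le> \<alpha> + 1 / Suc n" for n
    using \<Phi>_anti[OF Cn(1) C, of n] Cn(2)[of n] by (force simp: C_def)
  then have "\<Phi> C \<le> \<alpha>"
    using LIMSEQ_le_const[OF tendsto_add[OF tendsto_const[of \<alpha>] LIMSEQ_inverse_real_of_nat], of "\<Phi> C"]
    by (simp add: inverse_eq_divide)
  have "AE x in M. m C x \<le> z x" if "z \<in> S" for z
  proof -
    define D where "D = insert z C"
    have D: "D \<in> \<C>" "C \<subseteq> D" using C that by (auto simp: D_def \<C>_def)
    have "\<alpha> \<le> \<Phi> D" unfolding \<alpha>_def by (rule cINF_lower[OF \<Phi>_bdd D(1)])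
    with \<open>\<Phi> C \<le> \<alpha>\<close> \<Phi>_anti[OF C D] have "\<Phi> C = \<Phi> D" by linarith
    then have "(\<integral>x. m C x * w x - m D x * w x \<partial>M) = 0"
      using int[OF C] int[OF D(1)] by (simp add: \<Phi>_def)
    moreover have "0 \<le> m C x * w x - m D x * w x" for x
      using anti[OF C D, of x] w(2)[of x] by (simp add: mult_right_mono)
    ultimately have "AE x in M. m C x * w x - m D x * w x = 0"
      using int[OF C] int[OF D(1)]
      by (subst (asm) integral_nonneg_eq_0_iff_AE) auto
    then show ?thesis
    proof (rule AE_mp, intro AE_I2 impI)
      fix x assume "m C x * w x - m D x * w x = 0"
      then have "m C x = m D x" using w(2)[of x] by simp
      also have "\<dots> \<le> z x"
        unfolding m_def by (rule cINF_lower[OF bdd]) (use D in \<open>auto simp: D_def \<C>_def\<close>)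
      finally show "m C x \<le> z x" .
    qed
  qed
  then show thesis using that[of C] C by (simp add: \<C>_def m_def)
qed

text \<open>
  The bounded case applied to \<open>arctan \<circ> z\<close>.  The lower bound \<open>l\<close> ensures that almost everywhere
  the infimum of the countable subfamily is a genuine one: on the real numbers the infimum of an
  unbounded set carries no information.
\<close>

lemma (in sigma_finite_measure) essential_infimum:
  fixes S :: "('a \<Rightarrow> real) set"
  assumes meas: "\<And>z. z \<in> S \<Longrightarrow> z \<in> borel_measurable M"
    and lower: "\<And>z. z \<in> S \<Longrightarrow> AE x in M. l x \<le> z x"
    and "S \<noteq> {}"
  obtains w where "w \<in> borel_measurable M"
    "\<And>z. z \<in> S \<Longrightarrow> AE x in M. w x \<le> z x"
    "\<And>v. (\<And>z. z \<in> S \<Longrightarrow> AE x in M. v x \<le> z x) \<Longrightarrow> AE x in M. v x \<le> w x"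
proof -
  let ?A = "\<lambda>z x. arctan (z x)"
  obtain C' where C': "countable C'" "C' \<subseteq> ?A ` S" "C' \<noteq> {}"
    "\<And>z. z \<in> ?A ` S \<Longrightarrow> AE x in M. (INF c\<in>C'. c x) \<le> z x"
  proof (rule essential_infimum_bounded[of "?A ` S" "pi / 2"])
    show "z \<in> borel_measurable M" if "z \<in> ?A ` S" for z
      using that meas by auto
    show "\<bar>z x\<bar> \<le> pi / 2" if "z \<in> ?A ` S" for z x
    proof -
      obtain y where "z x = arctan y" using \<open>z \<in> ?A ` S\<close> by auto
      then show ?thesis using arctan_bounded[of y] by linarith
    qed
    show "?A ` S \<noteq> {}" using \<open>S \<noteq> {}\<close> by simp
  qed (rule that)
  obtain C where C: "C \<subseteq> S" "countable C" "C' = ?A ` C"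
    using C'(1,2) countable_subset_image[of C' ?A S] by blast
  have "C \<noteq> {}" using C C' by auto
  define w where "w = (\<lambda>x. INF c\<in>C. c x)"
  have "AE x in M. \<forall>c\<in>C. l x \<le> c x"
    using C lower by (subst AE_ball_countable) auto
  then have bdd: "AE x in M. bdd_below ((\<lambda>c. c x) ` C)"
    by (rule AE_mp) (auto intro!: AE_I2 bdd_belowI2)
  show thesis
  proof
    show "w \<in> borel_measurable M"
      unfolding w_def using C meas by (intro borel_measurable_cINF_real) auto
    show "AE x in M. w x \<le> z x" if "z \<in> S" for z
    proof -
      have "AE x in M. (INF c\<in>C'. c x) \<le> arctan (z x)" using that by (intro C') auto
      with bdd show ?thesis
      proof eventually_elim
        fix x assume b: "bdd_below ((\<lambda>c. c x) ` C)" and z: "(INF c\<in>C'. c x) \<le> arctan (z x)"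
        have "arctan (w x) \<le> (INF c\<in>C'. c x)"
        proof (rule cINF_greatest)
          fix c' assume "c' \<in> C'"
          then obtain c where "c \<in> C" "c' = ?A c" using C(3) by blast
          moreover have "w x \<le> c x" unfolding w_def by (rule cINF_lower[OF b \<open>c \<in> C\<close>])
          ultimately show "arctan (w x) \<le> c' x" by (simp add: arctan_le_iff)
        qed (rule C'(3))
        with z have "arctan (w x) \<le> arctan (z x)" by linarith
        then show "w x \<le> z x" by (simp add: arctan_le_iff)
      qed
    qed
    show "AE x in M. v x \<le> w x" if v: "\<And>z. z \<in> S \<Longrightarrow> AE x in M. v x \<le> z x" for v
    proof -
      have "AE x in M. \<forall>c\<in>C. v x \<le> c x"
        using C v by (subst AE_ball_countable) auto
      then show ?thesis
        by (rule AE_mp) (auto intro!: AE_I2 cINF_greatest \<open>C \<noteq> {}\<close> simp: w_def)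
    qed
  qed
qed

section \<open>Extremal fixed points in preorders\<close>

text \<open>
  The Knaster--Tarski argument for a preorder.  The conclusion gives \<open>x\<close> and \<open>T x\<close> as equivalent
  rather than equal, since antisymmetry fails for almost-everywhere inequality of functions.
\<close>

lemma least_prefixed_point:
  fixes le :: "'a \<Rightarrow> 'a \<Rightarrow> bool"
  assumes refl: "\<And>x. x \<in> A \<Longrightarrow> le x x"
    and trans: "\<And>x y z. x \<in> A \<Longrightarrow> y \<in> A \<Longrightarrow> z \<in> A \<Longrightarrow> le x y \<Longrightarrow> le y z \<Longrightarrow> le x z"
    and infima: "\<And>S. S \<subseteq> A \<Longrightarrow> \<exists>w\<in>A. (\<forall>z\<in>S. le w z) \<and> (\<forall>v\<in>A. (\<forall>z\<in>S. le v z) \<longrightarrow> le v w)"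
    and T: "\<And>x. x \<in> A \<Longrightarrow> T x \<in> A"
    and mono: "\<And>x y. x \<in> A \<Longrightarrow> y \<in> A \<Longrightarrow> le x y \<Longrightarrow> le (T x) (T y)"
  obtains x where "x \<in> A" "le x (T x)" "le (T x) x" "\<And>z. z \<in> A \<Longrightarrow> le (T z) z \<Longrightarrow> le x z"
proof -
  define S where "S = {z\<in>A. le (T z) z}"
  obtain w where w: "w \<in> A" "\<And>z. z \<in> S \<Longrightarrow> le w z"
      "\<And>v. v \<in> A \<Longrightarrow> (\<And>z. z \<in> S \<Longrightarrow> le v z) \<Longrightarrow> le v w"
    using infima[of S] by (auto simp: S_def)
  have Tw: "le (T w) w"
  proof (rule w(3))
    show "le (T w) z" if z: "z \<in> S" for z
      using trans[of "T w" "T z" z] mono[of w z] z w T by (auto simp: S_def)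
  qed (simp add: T w)
  have "T w \<in> S" using Tw w(1) T mono by (simp add: S_def)
  then have "le w (T w)" by (rule w(2))
  with that[of w] w Tw show thesis by (simp add: S_def)
qed

lemma suprema_from_infima:
  fixes le :: "'a \<Rightarrow> 'a \<Rightarrow> bool"
  assumes infima: "\<And>S. S \<subseteq> A \<Longrightarrow> \<exists>w\<in>A. (\<forall>z\<in>S. le w z) \<and> (\<forall>v\<in>A. (\<forall>z\<in>S. le v z) \<longrightarrow> le v w)"
    and "S \<subseteq> A"
  shows "\<exists>w\<in>A. (\<forall>z\<in>S. le z w) \<and> (\<forall>v\<in>A. (\<forall>z\<in>S. le z v) \<longrightarrow> le w v)"
proof -
  obtain w where "w \<in> A" "\<And>z. z \<in> A \<Longrightarrow> (\<forall>s\<in>S. le s z) \<Longrightarrow> le w z"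
    "\<And>v. v \<in> A \<Longrightarrow> (\<And>z. z \<in> A \<Longrightarrow> (\<forall>s\<in>S. le s z) \<Longrightarrow> le v z) \<Longrightarrow> le v w"
    using infima[of "{v\<in>A. \<forall>s\<in>S. le s v}"] by auto
  with \<open>S \<subseteq> A\<close> show ?thesis by (intro bexI[of _ w]) (simp_all add: subset_iff)
qed

section \<open>Locally integrable functions between two bounds\<close>

lemma Ico_in_lebesgue [measurable]: "Ico a b \<in> sets lebesgue"
proof (cases b)
  case (real r)
  then have "Ico a b = {a..<r}" by (auto simp: Ico_def)
  then show ?thesis by simp
next
  case PInf
  then have "Ico a b = {a..}" by (auto simp: Ico_def)
  then show ?thesis by simp
next
  case MInf
  then have "Ico a b = {}" by (auto simp: Ico_def)
  then show ?thesis by simp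
qed

text \<open>
  Countably many compact intervals \<open>[a, q]\<close> with rational \<open>q\<close> cover \<open>[a, b)\<close>, whether or not \<open>b\<close>
  is finite.
\<close>

lemma locally_HK_measurable:
  assumes "H \<in> locally_HK a b"
  shows "H \<in> borel_measurable (lebesgue_on (Ico a b))"
proof (rule measurable_piecewise_restrict)
  let ?C = "(\<lambda>q. {a..real_of_rat q}) ` {q. real_of_rat q \<in> Ico a b}"
  show "countable ?C" by simp
  show "\<Omega> \<inter> space (lebesgue_on (Ico a b)) \<in> sets (lebesgue_on (Ico a b))" if "\<Omega> \<in> ?C" for \<Omega>
    using that by (auto simp: sets_restrict_space)
  show "space (lebesgue_on (Ico a b)) \<subseteq> \<Union>?C"
  proof
    fix x assume "x \<in> space (lebesgue_on (Ico a b))"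
    then have x: "a \<le> x" "ereal x < b" by (auto simp: Ico_def)
    then obtain d where d: "ereal x < ereal d" "ereal d < b" using ereal_dense2[of "ereal x" b] by auto
    then obtain q where q: "x < real_of_rat q" "real_of_rat q < d" using of_rat_dense[of x d] by auto
    then have "real_of_rat q \<in> Ico a b"
      using x d less_trans[of "ereal (real_of_rat q)" "ereal d" b] by (auto simp: Ico_def)
    then show "x \<in> \<Union>?C" using x q by force
  qed
  show "H \<in> borel_measurable (restrict_space (lebesgue_on (Ico a b)) \<Omega>)" if "\<Omega> \<in> ?C" for \<Omega>
  proof -
    obtain q where q: "real_of_rat q \<in> Ico a b" "\<Omega> = {a..real_of_rat q}"
      using \<open>\<Omega> \<in> ?C\<close> by blast
    have "H \<in> borel_measurable (lebesgue_on \<Omega>)"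
      using integrable_imp_measurable[OF locally_HK_integrable[OF assms q(1)]] q(2) by simp
    moreover have "restrict_space (lebesgue_on (Ico a b)) \<Omega> = lebesgue_on (Ico a b \<inter> \<Omega>)"
      by (rule restrict_restrict_space) (simp_all add: q(2))
    moreover have "Ico a b \<inter> \<Omega> = \<Omega>" using Ico_Icc_subset[OF q(1)] q(2) by blast
    ultimately show ?thesis by simp
  qed
qed

text \<open>
  On a compact interval \<open>w - l\<close> is measurable and \<open>0 \<le> w - l \<le> u - l\<close> a.e., where \<open>u - l\<close> is
  integrable.  Hence \<open>w - l\<close> is integrable, and so is \<open>w\<close>, although neither \<open>l\<close> nor \<open>u\<close> need be
  absolutely integrable.
\<close>

lemma locally_HK_between:
  assumes l: "l \<in> locally_HK a b" and u: "u \<in> locally_HK a b"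
    and w: "w \<in> borel_measurable (lebesgue_on (Ico a b))" "w \<in> extensional (Ico a b)"
    and lw: "AE x in lebesgue_on (Ico a b). l x \<le> w x"
    and wu: "AE x in lebesgue_on (Ico a b). w x \<le> u x"
  shows "w \<in> locally_HK a b"
  unfolding locally_HK_def
proof (intro CollectI conjI allI impI w(2))
  fix s t assume st: "{s..t} \<subseteq> Ico a b"
  define N where "N = {x. \<not> (x \<in> Ico a b \<longrightarrow> l x \<le> w x \<and> w x \<le> u x)}"
  have "AE x in lebesgue_on (Ico a b). l x \<le> w x \<and> w x \<le> u x" using lw wu by eventually_elim simp
  then have "AE x in lebesgue. x \<in> Ico a b \<longrightarrow> l x \<le> w x \<and> w x \<le> u x"
    by (rule AE_restrict_space_iff[THEN iffD1, rotated]) simp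
  then have "N \<in> null_sets lebesgue"
    unfolding N_def by (simp add: completion.AE_iff_null_sets)
  then have N: "negligible N" "N \<in> sets lebesgue" by (auto simp: negligible_iff_null_sets)
  \<comment> \<open>Domination is needed everywhere, so all three functions are made \<open>0\<close> on the exceptional null set.\<close>
  let ?l' = "\<lambda>x. if x \<in> N then 0 else l x" and ?u' = "\<lambda>x. if x \<in> N then 0 else u x"
    and ?w' = "\<lambda>x. if x \<in> N then 0 else w x"
  have "l integrable_on {s..t}" "u integrable_on {s..t}" using l u st by (auto simp: locally_HK_def)
  then have int: "?l' integrable_on {s..t}" "?u' integrable_on {s..t}"
    by (auto intro: integrable_spike[OF _ N(1)])
  have "w \<in> borel_measurable (lebesgue_on {s..t})"
    using w(1) st by (rule measurable_restrict_mono)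
  then have "?w' \<in> borel_measurable (lebesgue_on {s..t})"
    by (intro measurable_If_set borel_measurable_const)
      (simp_all add: N(2) sets_restrict_space image_iff, metis Int_commute N(2))
  then have "(\<lambda>x. ?w' x - ?l' x) \<in> borel_measurable (lebesgue_on {s..t})"
    using integrable_imp_measurable[OF int(1)] by (rule borel_measurable_diff)
  then have "(\<lambda>x. ?w' x - ?l' x) integrable_on {s..t}"
    using integrable_diff[OF int(2,1)]
    by (rule measurable_bounded_by_integrable_imp_integrable) (use st in \<open>auto simp: N_def\<close>)
  then have "?w' integrable_on {s..t}" using integrable_add[OF _ int(1)] by fastforce
  then show "w integrable_on {s..t}" by (rule integrable_spike[OF _ N(1)]) auto
qed

lemma hk_class_of_in_HK_loc: "u \<in> locally_HK a b \<Longrightarrow> hk_class_of a b u \<in> HK_loc a b"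
  unfolding hk_class_of_def HK_loc_def by (rule quotientI)

lemma HK_le_hk_class_of:
  assumes "u \<in> locally_HK a b" "v \<in> locally_HK a b" "AE t in lebesgue_on (Ico a b). u t \<le> v t"
  shows "HK_le a b (hk_class_of a b u) (hk_class_of a b v)"
  unfolding HK_le_def
  using assms by (intro bexI[of _ u] bexI[of _ v]) (auto simp: hk_class_of_def ae_rel_def)

lemma hk_class_of_eqI:
  assumes "u \<in> locally_HK a b" "v \<in> locally_HK a b" "AE t in lebesgue_on (Ico a b). u t = v t"
  shows "hk_class_of a b u = hk_class_of a b v"
proof -
  have "AE t in lebesgue_on (Ico a b). u t = y t \<longleftrightarrow> v t = y t" for y
    using assms(3) by eventually_elim simp
  then have "(AE t in lebesgue_on (Ico a b). u t = y t) \<longleftrightarrow> (AE t in lebesgue_on (Ico a b). v t = y t)" for y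
    by (rule eventually_subst)
  then show ?thesis using assms(1,2) by (auto simp: hk_class_of_def ae_rel_def)
qed

definition ae_le :: "real \<Rightarrow> ereal \<Rightarrow> ('m \<Rightarrow> real \<Rightarrow> real) \<Rightarrow> ('m \<Rightarrow> real \<Rightarrow> real) \<Rightarrow> bool" where
  "ae_le a b u v \<longleftrightarrow> (\<forall>i. AE t in lebesgue_on (Ico a b). u i t \<le> v i t)"

lemma ae_le_refl: "ae_le a b u u"
  by (simp add: ae_le_def)

lemma ae_le_trans: "ae_le a b u v \<Longrightarrow> ae_le a b v w \<Longrightarrow> ae_le a b u w"
  unfolding ae_le_def
proof
  fix i
  assume "\<forall>i. AE t in lebesgue_on (Ico a b). u i t \<le> v i t" "\<forall>i. AE t in lebesgue_on (Ico a b). v i t \<le> w i t"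
  then have "AE t in lebesgue_on (Ico a b). u i t \<le> v i t" "AE t in lebesgue_on (Ico a b). v i t \<le> w i t" by auto
  then show "AE t in lebesgue_on (Ico a b). u i t \<le> w i t" by eventually_elim simp
qed

lemma Dlc_tuple_le_imp_ae_le: "Dlc_tuple_le a b u v \<Longrightarrow> ae_le a b u v"
  unfolding Dlc_tuple_le_def ae_le_def by (auto intro!: AE_I2)

lemma Dlc_tuple_le_trans: "Dlc_tuple_le a b u v \<Longrightarrow> Dlc_tuple_le a b v w \<Longrightarrow> Dlc_tuple_le a b u w"
  unfolding Dlc_tuple_le_def by (meson order_trans)

definition HK_between ::
    "real \<Rightarrow> ereal \<Rightarrow> ('m \<Rightarrow> real \<Rightarrow> real) \<Rightarrow> ('m \<Rightarrow> real \<Rightarrow> real) \<Rightarrow> ('m \<Rightarrow> real \<Rightarrow> real) set" where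
  "HK_between a b l u = {w. (\<forall>i. w i \<in> locally_HK a b) \<and> ae_le a b l w \<and> ae_le a b w u}"

text \<open>
  The infimum is formed in each component.  The empty family has the infimum \<open>u\<close>.
\<close>

lemma HK_between_infimum:
  assumes l: "\<And>i. l i \<in> locally_HK a b" and u: "\<And>i. u i \<in> locally_HK a b" and lu: "ae_le a b l u"
    and S: "S \<subseteq> HK_between a b l u"
  shows "\<exists>w\<in>HK_between a b l u. (\<forall>z\<in>S. ae_le a b w z) \<and>
           (\<forall>v\<in>HK_between a b l u. (\<forall>z\<in>S. ae_le a b v z) \<longrightarrow> ae_le a b v w)"
proof (cases "S = {}")
  case True
  then show ?thesis using u lu by (intro bexI[of _ u]) (auto simp: HK_between_def ae_le_def)
next
  case False
  let ?M = "lebesgue_on (Ico a b)"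
  interpret sigma_finite_measure ?M
    by (intro sigma_finite_measure_restrict_space sigma_finite_completion Ico_in_lebesgue)
      (rule lborel.sigma_finite_measure_axioms)
  let ?P = "\<lambda>i w. w \<in> locally_HK a b \<and> (AE x in ?M. l i x \<le> w x) \<and> (\<forall>z\<in>S. AE x in ?M. w x \<le> z i x) \<and>
      (\<forall>v. (\<forall>z\<in>S. AE x in ?M. v x \<le> z i x) \<longrightarrow> (AE x in ?M. v x \<le> w x))"
  have "\<exists>w. ?P i w" for i
  proof -
    let ?Si = "(\<lambda>z. z i) ` S"
    have Si: "z \<in> locally_HK a b" "AE x in ?M. l i x \<le> z x" "AE x in ?M. z x \<le> u i x" if "z \<in> ?Si" for z
      using that S by (auto simp: HK_between_def ae_le_def)
    obtain w0 where w0: "w0 \<in> borel_measurable ?M" "\<And>z. z \<in> ?Si \<Longrightarrow> AE x in ?M. w0 x \<le> z x"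
      "\<And>v. (\<And>z. z \<in> ?Si \<Longrightarrow> AE x in ?M. v x \<le> z x) \<Longrightarrow> AE x in ?M. v x \<le> w0 x"
      by (rule essential_infimum[of ?Si "l i"]) (use Si locally_HK_measurable False in blast)+
    define w where "w = restrict w0 (Ico a b)"
    have eq: "AE x in ?M. w x = w0 x" by (auto simp: w_def intro!: AE_I2)
    have w: "w \<in> borel_measurable ?M"
      using w0(1) by (rule measurable_cong[THEN iffD1, rotated]) (simp add: w_def)
    have lower: "AE x in ?M. w x \<le> z x" if "z \<in> ?Si" for z
      using w0(2)[OF that] eq by eventually_elim simp
    have greatest: "AE x in ?M. v x \<le> w x" if "\<And>z. z \<in> ?Si \<Longrightarrow> AE x in ?M. v x \<le> z x" for v
    proof -
      have "AE x in ?M. v x \<le> w0 x" by (rule w0(3)) (rule that)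
      with eq show ?thesis by eventually_elim simp
    qed
    obtain z0 where z0: "z0 \<in> ?Si" using False by blast
    have lw: "AE x in ?M. l i x \<le> w x" by (rule greatest) (rule Si(2))
    have "AE x in ?M. w x \<le> u i x" using lower[OF z0] Si(3)[OF z0] by eventually_elim simp
    then have "w \<in> locally_HK a b"
      by (intro locally_HK_between[OF l u w _ lw]) (unfold w_def, rule restrict_extensional)
    moreover have "\<forall>z\<in>S. AE x in ?M. w x \<le> z i x" using lower by blast
    moreover have "\<forall>v. (\<forall>z\<in>S. AE x in ?M. v x \<le> z i x) \<longrightarrow> (AE x in ?M. v x \<le> w x)"
      using greatest by blast
    ultimately show ?thesis using lw by blast
  qed
  then have "\<exists>w. \<forall>i. ?P i (w i)" by (intro choice allI)
  then obtain w where w: "\<forall>i. ?P i (w i)" by (rule exE)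
  have lower: "ae_le a b w z" if "z \<in> S" for z using w that by (simp add: ae_le_def)
  obtain z0 where "z0 \<in> S" using False by blast
  then have "ae_le a b w u" using S ae_le_trans[OF lower] by (auto simp: HK_between_def)
  then have "w \<in> HK_between a b l u" using w by (simp add: HK_between_def ae_le_def)
  moreover have "ae_le a b v w" if "\<forall>z\<in>S. ae_le a b v z" for v
    using that w by (simp add: ae_le_def)
  ultimately show ?thesis using lower by blast
qed

section \<open>The integral operator of the system\<close>

definition picard ::
    "real \<Rightarrow> ereal \<Rightarrow> 'm rhs \<Rightarrow> ('m \<Rightarrow> real) \<Rightarrow> ('m \<Rightarrow> real \<Rightarrow> real) \<Rightarrow> 'm \<Rightarrow> real \<Rightarrow> real" where
  "picard a b f c u = (\<lambda>i. primitive a b (c i) (f i (\<lambda>j. hk_class_of a b (u j))))"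

lemma classes_in_HK_tuples:
  "(\<And>i. u i \<in> locally_HK a b) \<Longrightarrow> (\<lambda>i. hk_class_of a b (u i)) \<in> HK_tuples a b"
  by (simp add: HK_tuples_def hk_class_of_in_HK_loc)

lemma picard_mono:
  assumes f: "increasing_maps a b f"
    and u: "\<And>i. u i \<in> locally_HK a b" and v: "\<And>i. v i \<in> locally_HK a b" and "ae_le a b u v"
  shows "Dlc_tuple_le a b (picard a b f c u) (picard a b f c v)"
proof -
  have le: "HK_tuple_le a b (\<lambda>j. hk_class_of a b (u j)) (\<lambda>j. hk_class_of a b (v j))"
    using assms by (auto simp: HK_tuple_le_def ae_le_def intro: HK_le_hk_class_of)
  have "A_D_le a b (f i (\<lambda>j. hk_class_of a b (u j))) (f i (\<lambda>j. hk_class_of a b (v j)))" for i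
  proof (rule monotone_onD[of "HK_tuples a b" "HK_tuple_le a b" "A_D_le a b" "f i"])
    show "monotone_on (HK_tuples a b) (HK_tuple_le a b) (A_D_le a b) (f i)"
      using f by (simp add: increasing_maps_def)
  qed (intro classes_in_HK_tuples u v le)+
  then show ?thesis by (simp add: Dlc_tuple_le_def A_D_le_def picard_def primitive_def)
qed

lemma picard_mono_data:
  assumes "\<And>i x. x \<in> HK_tuples a b \<Longrightarrow> A_D_le a b (f i x) (g i x)" and "\<And>i. c i \<le> d i"
    and u: "\<And>i. u i \<in> locally_HK a b"
  shows "Dlc_tuple_le a b (picard a b f c u) (picard a b g d u)"
  unfolding Dlc_tuple_le_def
proof (intro allI ballI)
  fix i x assume x: "x \<in> Ico a b"
  let ?X = "\<lambda>j. hk_class_of a b (u j)"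
  have "dist_integral a b (f i ?X) x \<le> dist_integral a b (g i ?X) x"
    using assms(1)[OF classes_in_HK_tuples[of u, OF u], of i] x by (simp add: A_D_le_def)
  then show "picard a b f c u i x \<le> picard a b g d u i x"
    using assms(2)[of i] x by (simp add: picard_def primitive_def add_mono)
qed

text \<open>
  The right-hand sides only see almost-everywhere classes; this is what later turns an a.e. fixed
  point into an exact one.
\<close>

lemma picard_ae_cong:
  assumes u: "\<And>i. u i \<in> locally_HK a b" and v: "\<And>i. v i \<in> locally_HK a b"
    and uv: "ae_le a b u v" and vu: "ae_le a b v u"
  shows "picard a b f c u = picard a b f c v"
proof -
  have "AE t in lebesgue_on (Ico a b). u i t = v i t" for i
    using uv[unfolded ae_le_def, rule_format, of i] vu[unfolded ae_le_def, rule_format, of i]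
    by eventually_elim simp
  then have "(\<lambda>j. hk_class_of a b (u j)) = (\<lambda>j. hk_class_of a b (v j))"
    by (intro ext hk_class_of_eqI u v)
  then show ?thesis by (simp add: picard_def)
qed

lemma Dlc_locally_HK: "F \<in> Dlc a b \<Longrightarrow> F \<in> locally_HK a b"
  by (simp add: Dlc_def)

lemma rhs_in_A_D:
  assumes "increasing_maps a b f" "\<And>i. u i \<in> locally_HK a b"
  shows "f i (\<lambda>j. hk_class_of a b (u j)) \<in> A_D a b"
proof (rule funcset_mem[of "f i" "HK_tuples a b" "A_D a b"])
  show "f i \<in> HK_tuples a b \<rightarrow> A_D a b" using assms(1) by (simp add: increasing_maps_def)
qed (rule classes_in_HK_tuples[of u, OF assms(2)])

lemma picard_in_Dlc:
  assumes "ereal a < b" "increasing_maps a b f" "\<And>i. u i \<in> locally_HK a b"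
  shows "picard a b f c u i \<in> Dlc a b"
  unfolding picard_def by (rule primitive_in_Dlc[OF assms(1) rhs_in_A_D[of a b f u, OF assms(2,3)]])

lemma solution_iff_picard_fixed:
  assumes ab: "ereal a < b" and f: "increasing_maps a b f"
  shows "solution a b f c y \<longleftrightarrow> y \<in> Dlc_tuples a b \<and> picard a b f c y = y"
proof (cases "y \<in> Dlc_tuples a b")
  case True
  then have y: "y i \<in> Dlc a b" for i by (simp add: Dlc_tuples_def)
  let ?g = "\<lambda>i. f i (\<lambda>j. hk_class_of a b (y j))"
  have g: "?g i \<in> A_D a b" for i by (rule rhs_in_A_D[OF f Dlc_locally_HK[OF y]])
  have "(dist_deriv a b (dist_of_fun a b (y i)) = ?g i \<and> y i a = c i) \<longleftrightarrow>
      primitive a b (c i) (?g i) = y i" for i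
  proof
    assume eq: "dist_deriv a b (dist_of_fun a b (y i)) = ?g i \<and> y i a = c i"
    show "primitive a b (c i) (?g i) = y i"
    proof (rule extensionalityI)
      show "primitive a b (c i) (?g i) \<in> extensional (Ico a b)" by (simp add: primitive_def)
      show "y i \<in> extensional (Ico a b)" using y by (auto simp: Dlc_def locally_HK_def)
      show "primitive a b (c i) (?g i) x = y i x" if "x \<in> Ico a b" for x
        using dist_integral_deriv[OF ab y that, of i] eq that by (simp add: primitive_def)
    qed
  next
    assume "primitive a b (c i) (?g i) = y i"
    then show "dist_deriv a b (dist_of_fun a b (y i)) = ?g i \<and> y i a = c i"
      using dist_deriv_primitive[OF ab g, of "c i" i] primitive_at_left_end[OF ab g, of "c i" i] by simp
  qed
  then show ?thesis using True by (simp add: solution_def picard_def) (auto simp: fun_eq_iff)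
qed (simp add: solution_def)

text \<open>
  The integral of the derivative of \<open>y\<^sub>i\<close> is \<open>y\<^sub>i(x) - y\<^sub>i(a)\<close>, and \<open>y\<^sub>i(a) \<le> c\<^sub>i\<close>.
\<close>

lemma subsolution_le_picard:
  assumes ab: "ereal a < b" and "subsolution a b f c y"
  shows "Dlc_tuple_le a b y (picard a b f c y)"
  unfolding Dlc_tuple_le_def
proof (intro allI ballI)
  fix i x assume x: "x \<in> Ico a b"
  let ?g = "f i (\<lambda>j. hk_class_of a b (y j))"
  have y: "y i \<in> Dlc a b" "y i a \<le> c i" using assms(2) by (auto simp: subsolution_def Dlc_tuples_def)
  have "dist_integral a b (dist_deriv a b (dist_of_fun a b (y i))) x \<le> dist_integral a b ?g x"
    using assms(2) x by (simp add: subsolution_def A_D_le_def)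
  then show "y i x \<le> picard a b f c y i x"
    using dist_integral_deriv[OF ab y(1) x] y(2) x by (simp add: picard_def primitive_def)
qed

lemma picard_le_supersolution:
  assumes ab: "ereal a < b" and "supersolution a b f c y"
  shows "Dlc_tuple_le a b (picard a b f c y) y"
  unfolding Dlc_tuple_le_def
proof (intro allI ballI)
  fix i x assume x: "x \<in> Ico a b"
  let ?g = "f i (\<lambda>j. hk_class_of a b (y j))"
  have y: "y i \<in> Dlc a b" "c i \<le> y i a" using assms(2) by (auto simp: supersolution_def Dlc_tuples_def)
  have "dist_integral a b ?g x \<le> dist_integral a b (dist_deriv a b (dist_of_fun a b (y i))) x"
    using assms(2) x by (simp add: supersolution_def A_D_le_def)
  then show "picard a b f c y i x \<le> y i x"
    using dist_integral_deriv[OF ab y(1) x] y(2) x by (simp add: picard_def primitive_def)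
qed

locale bracketed_system =
  fixes a :: real and b :: ereal and f :: "'m rhs" and c :: "'m \<Rightarrow> real" and l u :: "'m \<Rightarrow> real \<Rightarrow> real"
  assumes ab: "ereal a < b" and inc: "increasing_maps a b f"
    and sub: "subsolution a b f c l" and super: "supersolution a b f c u"
    and lu: "Dlc_tuple_le a b l u"
begin

abbreviation "A \<equiv> HK_between a b l u"
abbreviation "T \<equiv> picard a b f c"

lemma bounds_Dlc: "l i \<in> Dlc a b" "u i \<in> Dlc a b"
  using sub super unfolding subsolution_def supersolution_def Dlc_tuples_def by simp_all

lemma A_locally_HK: "w \<in> A \<Longrightarrow> w i \<in> locally_HK a b"
  by (simp add: HK_between_def)

lemma picard_in_order_interval:
  assumes "w \<in> A" shows "T w \<in> order_interval a b l u"
proof -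
  have "Dlc_tuple_le a b (T l) (T w)" "Dlc_tuple_le a b (T w) (T u)"
    using assms bounds_Dlc[THEN Dlc_locally_HK] by (auto intro!: picard_mono inc simp: HK_between_def)
  then have "Dlc_tuple_le a b l (T w)" "Dlc_tuple_le a b (T w) u"
    using subsolution_le_picard[OF ab sub] picard_le_supersolution[OF ab super]
    by (blast intro: Dlc_tuple_le_trans)+
  then show ?thesis
    using picard_in_Dlc[OF ab inc A_locally_HK[OF assms]] by (simp add: order_interval_def Dlc_tuples_def)
qed

lemma order_interval_subset: "order_interval a b l u \<subseteq> A"
  by (simp add: order_interval_def Dlc_tuples_def HK_between_def subset_iff Dlc_locally_HK
      Dlc_tuple_le_imp_ae_le)

lemma picard_in_A: "w \<in> A \<Longrightarrow> T w \<in> A"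
  by (rule subsetD[OF order_interval_subset picard_in_order_interval])

lemma picard_mono_A: "v \<in> A \<Longrightarrow> w \<in> A \<Longrightarrow> ae_le a b v w \<Longrightarrow> Dlc_tuple_le a b (T v) (T w)"
  by (rule picard_mono[OF inc A_locally_HK A_locally_HK])

lemma infima: "S \<subseteq> A \<Longrightarrow> \<exists>w\<in>A. (\<forall>z\<in>S. ae_le a b w z) \<and> (\<forall>v\<in>A. (\<forall>z\<in>S. ae_le a b v z) \<longrightarrow> ae_le a b v w)"
  by (rule HK_between_infimum[OF Dlc_locally_HK[OF bounds_Dlc(1)] Dlc_locally_HK[OF bounds_Dlc(2)]
      Dlc_tuple_le_imp_ae_le[OF lu]])

lemma ae_fixed_point_solution:
  assumes w: "w \<in> A" and "ae_le a b w (T w)" "ae_le a b (T w) w"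
  shows "solution a b f c (T w)"
proof -
  have "T (T w) = T w"
    by (rule picard_ae_cong[OF A_locally_HK[OF picard_in_A[OF w]] A_locally_HK[OF w] assms(3,2)])
  moreover have "T w \<in> Dlc_tuples a b" using picard_in_order_interval[OF w] by (simp add: order_interval_def)
  ultimately show ?thesis by (simp add: solution_iff_picard_fixed[OF ab inc])
qed

text \<open>
  The comparison is with all \<open>z\<close> such that \<open>T z \<le> z\<close>, not only with solutions: solutions of a
  system with larger data have this property as well.
\<close>

lemma least_solution:
  obtains y where "y \<in> order_interval a b l u" "solution a b f c y"
    "\<And>z. z \<in> order_interval a b l u \<Longrightarrow> Dlc_tuple_le a b (T z) z \<Longrightarrow> Dlc_tuple_le a b y z"
proof -
  obtain w where w: "w \<in> A" "ae_le a b w (T w)" "ae_le a b (T w) w"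
    and least: "\<And>z. z \<in> A \<Longrightarrow> ae_le a b (T z) z \<Longrightarrow> ae_le a b w z"
  proof (rule least_prefixed_point[of A "ae_le a b" T])
    show "ae_le a b v w" if "ae_le a b v z" "ae_le a b z w" for v z w :: "'m \<Rightarrow> real \<Rightarrow> real"
      using that by (rule ae_le_trans)
    show "ae_le a b (T v) (T w)" if "v \<in> A" "w \<in> A" "ae_le a b v w" for v w
      using that by (rule Dlc_tuple_le_imp_ae_le[OF picard_mono_A])
  qed (rule ae_le_refl infima picard_in_A that; assumption)+
  show thesis
  proof (rule that[of "T w"])
    fix z assume z: "z \<in> order_interval a b l u" "Dlc_tuple_le a b (T z) z"
    then have "z \<in> A" using order_interval_subset by blast
    then have "Dlc_tuple_le a b (T w) (T z)"
      using w(1) least z(2) by (blast intro: picard_mono_A Dlc_tuple_le_imp_ae_le)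
    then show "Dlc_tuple_le a b (T w) z" using z(2) by (rule Dlc_tuple_le_trans)
  qed (intro picard_in_order_interval ae_fixed_point_solution w)+
qed

lemma greatest_solution:
  obtains y where "y \<in> order_interval a b l u" "solution a b f c y"
    "\<And>z. z \<in> order_interval a b l u \<Longrightarrow> Dlc_tuple_le a b z (T z) \<Longrightarrow> Dlc_tuple_le a b z y"
proof -
  obtain w where w: "w \<in> A" "ae_le a b w (T w)" "ae_le a b (T w) w"
    and greatest: "\<And>z. z \<in> A \<Longrightarrow> ae_le a b z (T z) \<Longrightarrow> ae_le a b z w"
  proof (rule least_prefixed_point[of A "\<lambda>v w. ae_le a b w v" T])
    show "ae_le a b w v" if "ae_le a b z v" "ae_le a b w z" for v z w :: "'m \<Rightarrow> real \<Rightarrow> real"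
      using that(2,1) by (rule ae_le_trans)
    show "ae_le a b (T w) (T v)" if "v \<in> A" "w \<in> A" "ae_le a b w v" for v w
      using that(2,1,3) by (rule Dlc_tuple_le_imp_ae_le[OF picard_mono_A])
    show "\<exists>w\<in>A. (\<forall>z\<in>S. ae_le a b z w) \<and> (\<forall>v\<in>A. (\<forall>z\<in>S. ae_le a b z v) \<longrightarrow> ae_le a b w v)"
      if "S \<subseteq> A" for S
      using infima that by (rule suprema_from_infima)
  qed (rule ae_le_refl picard_in_A that; assumption)+
  show thesis
  proof (rule that[of "T w"])
    fix z assume z: "z \<in> order_interval a b l u" "Dlc_tuple_le a b z (T z)"
    then have "z \<in> A" using order_interval_subset by blast
    then have "Dlc_tuple_le a b (T z) (T w)"
      using w(1) greatest z(2) by (blast intro: picard_mono_A Dlc_tuple_le_imp_ae_le)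
    with z(2) show "Dlc_tuple_le a b z (T w)" by (rule Dlc_tuple_le_trans)
  qed (intro picard_in_order_interval ae_fixed_point_solution w)+
qed

end

theorem theorem7p1:
  fixes a :: real and b :: ereal
    and c :: "'m::finite \<Rightarrow> real"
    and f :: "'m \<Rightarrow> ('m \<Rightarrow> hk_class) \<Rightarrow> dist"
    and ylo yup :: "'m \<Rightarrow> real \<Rightarrow> real"
  assumes "ereal a < b"
    and "increasing_maps a b f"
    and "subsolution a b f c ylo"
    and "supersolution a b f c yup"
    and "Dlc_tuple_le a b ylo yup"
  shows "(\<exists>y. smallest_solution a b f c (order_interval a b ylo yup) y) \<and>
         (\<exists>y. greatest_solution a b f c (order_interval a b ylo yup) y) \<and>
         (\<forall>(fh :: 'm \<Rightarrow> ('m \<Rightarrow> hk_class) \<Rightarrow> dist) (ch :: 'm \<Rightarrow> real).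
            increasing_maps a b fh \<longrightarrow>
            subsolution a b fh ch ylo \<longrightarrow>
            supersolution a b fh ch yup \<longrightarrow>
            (\<forall>i. \<forall>x\<in>HK_tuples a b. A_D_le a b (f i x) (fh i x)) \<longrightarrow>
            (\<forall>i. c i \<le> ch i) \<longrightarrow>
            (\<forall>y yh.
               smallest_solution a b f c (order_interval a b ylo yup) y \<longrightarrow>
               smallest_solution a b fh ch (order_interval a b ylo yup) yh \<longrightarrow>
               Dlc_tuple_le a b y yh) \<and>
            (\<forall>y yh.
               greatest_solution a b f c (order_interval a b ylo yup) y \<longrightarrow>
               greatest_solution a b fh ch (order_interval a b ylo yup) yh \<longrightarrow>
               Dlc_tuple_le a b y yh))"
proof -
  let ?I = "order_interval a b ylo yup"
  interpret bracketed_system a b f c ylo yup using assms by unfold_locales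
  obtain y0 where y0: "y0 \<in> ?I" "solution a b f c y0"
    "\<And>z. z \<in> ?I \<Longrightarrow> Dlc_tuple_le a b (picard a b f c z) z \<Longrightarrow> Dlc_tuple_le a b y0 z"
    using least_solution by blast
  have fixed: "picard a b f c z = z" if "solution a b f c z" for z
    using that solution_iff_picard_fixed[OF assms(1,2)] by blast
  obtain y1 where y1: "y1 \<in> ?I" "solution a b f c y1"
    "\<And>z. z \<in> ?I \<Longrightarrow> Dlc_tuple_le a b z (picard a b f c z) \<Longrightarrow> Dlc_tuple_le a b z y1"
    using greatest_solution by blast
  have refl: "Dlc_tuple_le a b z z" for z :: "'m \<Rightarrow> real \<Rightarrow> real" by (simp add: Dlc_tuple_le_def)
  have "smallest_solution a b f c ?I y0"
    unfolding smallest_solution_def using y0 fixed refl by metis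
  moreover have "greatest_solution a b f c ?I y1"
    unfolding greatest_solution_def using y1 fixed refl by metis
  moreover have "(smallest_solution a b f c ?I y \<longrightarrow> smallest_solution a b fh ch ?I yh \<longrightarrow> Dlc_tuple_le a b y yh) \<and>
      (greatest_solution a b f c ?I y \<longrightarrow> greatest_solution a b fh ch ?I yh \<longrightarrow> Dlc_tuple_le a b y yh)"
    if fh: "increasing_maps a b fh" "subsolution a b fh ch ylo" "supersolution a b fh ch yup"
      and data: "\<forall>i. \<forall>x\<in>HK_tuples a b. A_D_le a b (f i x) (fh i x)" "\<forall>i. c i \<le> ch i"
    for fh :: "'m \<Rightarrow> ('m \<Rightarrow> hk_class) \<Rightarrow> dist" and ch y yh
  proof (intro conjI impI)
    have fixedh: "picard a b fh ch z = z" if "solution a b fh ch z" for z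
      using that solution_iff_picard_fixed[OF assms(1) fh(1)] by blast
    \<comment> \<open>With this, \<open>yh\<close> satisfies \<open>picard yh \<le> yh\<close> for the data \<open>(f, c)\<close>, and \<open>y\<close> satisfies \<open>y \<le> picard y\<close> for \<open>(fh, ch)\<close>.\<close>
    have le: "Dlc_tuple_le a b (picard a b f c z) (picard a b fh ch z)" if "z \<in> ?I" for z
      using data that
      by (intro picard_mono_data) (auto simp: order_interval_def Dlc_tuples_def Dlc_locally_HK)
    {
      assume y: "smallest_solution a b f c ?I y" and yh: "smallest_solution a b fh ch ?I yh"
      have "yh \<in> ?I" "picard a b fh ch yh = yh" using yh fixedh by (auto simp: smallest_solution_def)
      then have "Dlc_tuple_le a b y0 yh" using y0(3)[of yh] le[of yh] by simp
      moreover have "Dlc_tuple_le a b y y0" using y y0 by (simp add: smallest_solution_def)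
      ultimately show "Dlc_tuple_le a b y yh" by (blast intro: Dlc_tuple_le_trans)
    next
      assume y: "greatest_solution a b f c ?I y" and yh: "greatest_solution a b fh ch ?I yh"
      interpret hat: bracketed_system a b fh ch ylo yup using assms fh by unfold_locales
      obtain y2 where y2: "y2 \<in> ?I" "solution a b fh ch y2"
        "\<And>z. z \<in> ?I \<Longrightarrow> Dlc_tuple_le a b z (picard a b fh ch z) \<Longrightarrow> Dlc_tuple_le a b z y2"
        using hat.greatest_solution by blast
      have "y \<in> ?I" "picard a b f c y = y" using y fixed by (auto simp: greatest_solution_def)
      then have "Dlc_tuple_le a b y y2" using y2(3)[of y] le[of y] by simp
      moreover have "Dlc_tuple_le a b y2 yh" using yh y2 by (simp add: greatest_solution_def)
      ultimately show "Dlc_tuple_le a b y yh" by (blast intro: Dlc_tuple_le_trans)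
    }
  qed
  ultimately show ?thesis by blast
qed

end
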